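(* Let $\Theta$ be the variety of all actions of semigroups over sets. Automorphic equivalence in $\Theta$ coincides with geometric equivalence; that is, for all $H_1,H_2\in\Theta$, $H_1$ and $H_2$ are automorphically equivalent if and only if they are geometrically equivalent.
   Context: An action of a semigroup over a set is a two-sorted algebra $H$ with sorts $\Gamma=\{1,2\}$: $H^{(1)}$ is the set of elements of the semigroup, $H^{(2)}$ is the set acted upon (either of them may be empty), with operations $\cdot$ of type $(1,1;1)$ (multiplication in the semigroup, associative) and $\circ$ of type $(1,2;2)$ (action), satisfying $(a\cdot b)\circ y=a\circ(b\circ y)$. The variety $\Theta$ consists of all such algebras. A homomorphism $\varphi:A\to B$ is a sort-preserving map $A^{(1)}\sqcup A^{(2)}\to B^{(1)}\sqcup B^{(2)}$ commuting with both operations (none exists if $A^{(i)}\neq\varnothing=B^{(i)}$ for some $i$). Let $X_0$ be a two-sorted set with countably infinitely many elements of each sort. The objects of the category $\Theta^0$ are the free algebras $F(X)$ of $\Theta$ with $X\subset X_0$ finite, the morphisms are all homomorphisms. ($F(X)$ is free if for every $A\in\Theta$ having elements of every sort occurring in $X$, every sort-preserving map $X\to A$ extends to a unique homomorphism $F(X)\to A$.) For $F\in\mathrm{Ob}\,\Theta^0$, $H\in\Theta$ and $T\subseteq(F^{(1)})^2\cup(F^{(2)})^2$ put $T_H''=\bigcap\{\ker\varphi\mid\varphi\in\mathrm{Hom}(F,H),\ T\subseteq\ker\varphi\}$, where $\ker\varphi=\{(a,b)\mid\varphi(a)=\varphi(b)\}$ and the intersection of the empty family is $(F^{(1)})^2\cup(F^{(2)})^2$.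 $T$ is algebraically closed over $H$ if $T_H''=T$; $Cl_H(F)$ is the family of all such algebraically closed $T$. Algebras $H_1,H_2\in\Theta$ are geometrically equivalent if $T_{H_1}''=T_{H_2}''$ for every $F\in\mathrm{Ob}\,\Theta^0$ and every $T\subseteq(F^{(1)})^2\cup(F^{(2)})^2$. Algebras $H_1,H_2\in\Theta$ are automorphically equivalent if there exist an automorphism $\Phi:\Theta^0\to\Theta^0$ and bijections $\alpha(\Phi)_A:Cl_{H_1}(A)\to Cl_{H_2}(\Phi(A))$ for every $A\in\mathrm{Ob}\,\Theta^0$ such that for all $A_1,A_2\in\mathrm{Ob}\,\Theta^0$, $\mu_1,\mu_2\in\mathrm{Hom}(A_1,A_2)$ and $T\in Cl_{H_1}(A_2)$: $\tau\mu_1=\tau\mu_2$ if and only if $\widetilde\tau\Phi(\mu_1)=\widetilde\tau\Phi(\mu_2)$, where $\tau:A_2\to A_2/T$ and $\widetilde\tau:\Phi(A_2)\to\Phi(A_2)/\alpha(\Phi)_{A_2}(T)$ are the natural epimorphisms. *)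

theory Defs
  imports Main "HOL-Library.FuncSet"
begin

section \<open>Actions of semigroups over sets\<close>

text \<open>
  A two-sorted algebra: \<open>sgrp\<close> and \<open>pts\<close> are the carriers of sort 1 and sort 2, either of which
  may be empty.  The operations are total on the underlying types; only their values on the
  carriers matter.
\<close>

record ('a, 'b) sg_action =
  sgrp :: "'a set"
  pts :: "'b set"
  mul :: "'a \<Rightarrow> 'a \<Rightarrow> 'a"
  act :: "'a \<Rightarrow> 'b \<Rightarrow> 'b"

definition is_action :: "('a, 'b) sg_action \<Rightarrow> bool" where
  "is_action H \<longleftrightarrow>
     (\<forall>a\<in>sgrp H. \<forall>b\<in>sgrp H. mul H a b \<in> sgrp H) \<and>
     (\<forall>a\<in>sgrp H. \<forall>y\<in>pts H. act H a y \<in> pts H) \<and>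
     (\<forall>a\<in>sgrp H. \<forall>b\<in>sgrp H. \<forall>c\<in>sgrp H. mul H (mul H a b) c = mul H a (mul H b c)) \<and>
     (\<forall>a\<in>sgrp H. \<forall>b\<in>sgrp H. \<forall>y\<in>pts H. act H (mul H a b) y = act H a (act H b y))"

text \<open>
  A sort-preserving map is the pair of its two components.  The components are extensional
  (\<open>undefined\<close> off the carrier), so equality in HOL is equality of maps.
\<close>

definition Hom :: "('a, 'b) sg_action \<Rightarrow> ('c, 'd) sg_action \<Rightarrow> (('a \<Rightarrow> 'c) \<times> ('b \<Rightarrow> 'd)) set" where
  "Hom A B = {(f, g). f \<in> sgrp A \<rightarrow>\<^sub>E sgrp B \<and> g \<in> pts A \<rightarrow>\<^sub>E pts B \<and>
     (\<forall>a\<in>sgrp A. \<forall>b\<in>sgrp A. f (mul A a b) = mul B (f a) (f b)) \<and>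
     (\<forall>a\<in>sgrp A. \<forall>y\<in>pts A. g (act A a y) = act B (f a) (g y))}"

definition hom_id :: "('a, 'b) sg_action \<Rightarrow> ('a \<Rightarrow> 'a) \<times> ('b \<Rightarrow> 'b)" where
  "hom_id A = (\<lambda>a\<in>sgrp A. a, \<lambda>y\<in>pts A. y)"

definition hom_comp :: "('a, 'b) sg_action \<Rightarrow> ('c \<Rightarrow> 'e) \<times> ('d \<Rightarrow> 'f) \<Rightarrow> ('a \<Rightarrow> 'c) \<times> ('b \<Rightarrow> 'd)
    \<Rightarrow> ('a \<Rightarrow> 'e) \<times> ('b \<Rightarrow> 'f)" where
  "hom_comp A \<psi> \<phi> = (compose (sgrp A) (fst \<psi>) (fst \<phi>), compose (pts A) (snd \<psi>) (snd \<phi>))"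


section \<open>The category of finitely generated free actions\<close>

text \<open>
  The generators of either sort are the natural numbers.  The free action on \<open>X\<close> consists of the
  nonempty words over \<open>fst X\<close> under concatenation, acting on the formal products \<open>w \<circ> y\<close>, written
  \<open>(w, y)\<close>, with \<open>y \<in> snd X\<close> and \<open>w\<close> a possibly empty word over \<open>fst X\<close>.
\<close>

type_synonym word_action = "(nat list, nat list \<times> nat) sg_action"
type_synonym word_hom = "(nat list \<Rightarrow> nat list) \<times> (nat list \<times> nat \<Rightarrow> nat list \<times> nat)"

definition free_action :: "nat set \<times> nat set \<Rightarrow> word_action" where
  "free_action X =
     \<lparr>sgrp = lists (fst X) - {[]}, pts = lists (fst X) \<times> snd X,
      mul = (@), act = (\<lambda>u (w, y). (u @ w, y))\<rparr>"

definition Ob :: "word_action set" where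
  "Ob = {free_action X | X. finite (fst X) \<and> finite (snd X)}"

text \<open>
  A functor is given by its object map \<open>\<Phi>o\<close> and its arrow maps \<open>\<Phi>m A B\<close> on \<open>Hom A B\<close>; the latter
  depend on \<open>B\<close> because an extensional function does not determine its codomain.
\<close>

definition category_automorphism ::
  "(word_action \<Rightarrow> word_action) \<Rightarrow> (word_action \<Rightarrow> word_action \<Rightarrow> word_hom \<Rightarrow> word_hom) \<Rightarrow> bool" where
  "category_automorphism \<Phi>o \<Phi>m \<longleftrightarrow>
     bij_betw \<Phi>o Ob Ob \<and>
     (\<forall>A\<in>Ob. \<forall>B\<in>Ob. bij_betw (\<Phi>m A B) (Hom A B) (Hom (\<Phi>o A) (\<Phi>o B))) \<and>
     (\<forall>A\<in>Ob. \<Phi>m A A (hom_id A) = hom_id (\<Phi>o A)) \<and>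
     (\<forall>A\<in>Ob. \<forall>B\<in>Ob. \<forall>C\<in>Ob. \<forall>\<mu>\<in>Hom A B. \<forall>\<nu>\<in>Hom B C.
        \<Phi>m A C (hom_comp A \<nu> \<mu>) = hom_comp (\<Phi>o A) (\<Phi>m B C \<nu>) (\<Phi>m A B \<mu>))"


section \<open>Algebraically closed sets and the two equivalences\<close>

text \<open>
  A sort-respecting relation on \<open>A\<close> is a relation on the disjoint union of the two carriers;
  \<open>sort_square A\<close> is the largest one.
\<close>

definition sort_square :: "('a, 'b) sg_action \<Rightarrow> ('a + 'b) rel" where
  "sort_square A = {(Inl a, Inl a') | a a'. a \<in> sgrp A \<and> a' \<in> sgrp A} \<union>
                   {(Inr y, Inr y') | y y'. y \<in> pts A \<and> y' \<in> pts A}"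

definition hom_ker :: "('a, 'b) sg_action \<Rightarrow> ('a \<Rightarrow> 'c) \<times> ('b \<Rightarrow> 'd) \<Rightarrow> ('a + 'b) rel" where
  "hom_ker A \<phi> = {(u, v) \<in> sort_square A. map_sum (fst \<phi>) (snd \<phi>) u = map_sum (fst \<phi>) (snd \<phi>) v}"

text \<open>The intersection with \<open>sort_square F\<close> is effective only for the empty family of kernels.\<close>

definition alg_closure ::
  "('a, 'b) sg_action \<Rightarrow> ('c, 'd) sg_action \<Rightarrow> ('a + 'b) rel \<Rightarrow> ('a + 'b) rel" where
  "alg_closure F H T = sort_square F \<inter> \<Inter>{hom_ker F \<phi> | \<phi>. \<phi> \<in> Hom F H \<and> T \<subseteq> hom_ker F \<phi>}"

definition alg_closed :: "('c, 'd) sg_action \<Rightarrow> ('a, 'b) sg_action \<Rightarrow> ('a + 'b) rel set" where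
  "alg_closed H F = {T. T \<subseteq> sort_square F \<and> alg_closure F H T = T}"

definition geometrically_equivalent :: "('a, 'b) sg_action \<Rightarrow> ('c, 'd) sg_action \<Rightarrow> bool" where
  "geometrically_equivalent H1 H2 \<longleftrightarrow>
     (\<forall>F\<in>Ob. \<forall>T. T \<subseteq> sort_square F \<longrightarrow> alg_closure F H1 T = alg_closure F H2 T)"

text \<open>
  In the quotient, a class of either sort is a subset of the disjoint union of the carriers.  The
  operations multiply the members of the classes and take the class of the result.
\<close>

definition quot_action ::
  "('a, 'b) sg_action \<Rightarrow> ('a + 'b) rel \<Rightarrow> (('a + 'b) set, ('a + 'b) set) sg_action" where
  "quot_action A T =
     \<lparr>sgrp = (\<lambda>a. T `` {Inl a}) ` sgrp A, pts = (\<lambda>y. T `` {Inr y}) ` pts A,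
      mul = (\<lambda>C D. T `` {Inl (mul A a b) | a b. Inl a \<in> C \<and> Inl b \<in> D}),
      act = (\<lambda>C D. T `` {Inr (act A a y) | a y. Inl a \<in> C \<and> Inr y \<in> D})\<rparr>"

definition quot_map ::
  "('a, 'b) sg_action \<Rightarrow> ('a + 'b) rel \<Rightarrow> ('a \<Rightarrow> ('a + 'b) set) \<times> ('b \<Rightarrow> ('a + 'b) set)" where
  "quot_map A T = (\<lambda>a\<in>sgrp A. T `` {Inl a}, \<lambda>y\<in>pts A. T `` {Inr y})"

definition automorphically_equivalent :: "('a, 'b) sg_action \<Rightarrow> ('c, 'd) sg_action \<Rightarrow> bool" where
  "automorphically_equivalent H1 H2 \<longleftrightarrow>
     (\<exists>\<Phi>o \<Phi>m. category_automorphism \<Phi>o \<Phi>m \<and>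
       (\<exists>\<alpha>. (\<forall>A\<in>Ob. bij_betw (\<alpha> A) (alg_closed H1 A) (alg_closed H2 (\<Phi>o A))) \<and>
            (\<forall>A1\<in>Ob. \<forall>A2\<in>Ob. \<forall>\<mu>1\<in>Hom A1 A2. \<forall>\<mu>2\<in>Hom A1 A2. \<forall>T\<in>alg_closed H1 A2.
               hom_comp A1 (quot_map A2 T) \<mu>1 = hom_comp A1 (quot_map A2 T) \<mu>2 \<longleftrightarrow>
               hom_comp (\<Phi>o A1) (quot_map (\<Phi>o A2) (\<alpha> A2 T)) (\<Phi>m A1 A2 \<mu>1) =
               hom_comp (\<Phi>o A1) (quot_map (\<Phi>o A2) (\<alpha> A2 T)) (\<Phi>m A1 A2 \<mu>2))))"


section \<open>Adequacy of the concrete models\<close>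

lemma is_action_free_action: "is_action (free_action X)"
  by (auto simp: is_action_def free_action_def)

lemma inj_free_action: "inj free_action"
proof (rule injI)
  fix X Y assume "free_action X = free_action Y"
  then have 1: "lists (fst X) - {[]} = lists (fst Y) - {[]}"
    and 2: "lists (fst X) \<times> snd X = lists (fst Y) \<times> snd Y"
    by (auto simp: free_action_def)
  have "x \<in> fst X \<longleftrightarrow> x \<in> fst Y" for x
    using arg_cong[OF 1, of "\<lambda>S. [x] \<in> S"] by simp
  moreover have "y \<in> snd X \<longleftrightarrow> y \<in> snd Y" for y
    using arg_cong[OF 2, of "\<lambda>S. ([], y) \<in> S"] by simp
  ultimately show "X = Y" by (auto simp: prod_eq_iff)
qed

primrec word_value :: "('a, 'b) sg_action \<Rightarrow> (nat \<Rightarrow> 'a) \<Rightarrow> nat list \<Rightarrow> 'a" where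
  "word_value A f [] = undefined"
| "word_value A f (x # w) = (if w = [] then f x else mul A (f x) (word_value A f w))"

text \<open>
  The existence of \<open>f\<close> and \<open>g\<close> already forces \<open>A\<close> to have elements of every sort occurring in \<open>X\<close>.
\<close>

theorem free_action_universal:
  assumes A: "is_action A" and f: "f \<in> fst X \<rightarrow> sgrp A" and g: "g \<in> snd X \<rightarrow> pts A"
  shows "\<exists>!\<phi>. \<phi> \<in> Hom (free_action X) A \<and>
              (\<forall>x\<in>fst X. fst \<phi> [x] = f x) \<and> (\<forall>y\<in>snd X. snd \<phi> ([], y) = g y)"
proof -
  let ?F = "free_action X"
  have F: "sgrp ?F = lists (fst X) - {[]}" "pts ?F = lists (fst X) \<times> snd X"
    "mul ?F = (@)" "act ?F = (\<lambda>u (w, y). (u @ w, y))"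
    by (simp_all add: free_action_def)
  have cl: "mul A a b \<in> sgrp A" if "a \<in> sgrp A" "b \<in> sgrp A" for a b
    using A that by (auto simp: is_action_def)
  have cl2: "act A a y \<in> pts A" if "a \<in> sgrp A" "y \<in> pts A" for a y
    using A that by (auto simp: is_action_def)
  have as: "mul A (mul A a b) c = mul A a (mul A b c)"
    if "a \<in> sgrp A" "b \<in> sgrp A" "c \<in> sgrp A" for a b c
    using A that by (auto simp: is_action_def)
  have as2: "act A (mul A a b) y = act A a (act A b y)"
    if "a \<in> sgrp A" "b \<in> sgrp A" "y \<in> pts A" for a b y
    using A that by (auto simp: is_action_def)
  define p where "p = word_value A f"
  define q where "q = (\<lambda>(w, y). foldr (\<lambda>x. act A (f x)) w (g y))"
  have fx: "f x \<in> sgrp A" if "x \<in> fst X" for x using f that by auto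
  have gy: "g y \<in> pts A" if "y \<in> snd X" for y using g that by auto
  have p: "p w \<in> sgrp A" if "w \<in> lists (fst X)" "w \<noteq> []" for w
    using that by (induction w) (auto simp: p_def intro: fx cl)
  have q: "q (w, y) \<in> pts A" if "w \<in> lists (fst X)" "y \<in> snd X" for w y
    using that(1) by (induction w) (auto simp: q_def intro: fx gy that cl2)
  have pm: "p (u @ v) = mul A (p u) (p v)"
    if "u \<in> lists (fst X)" "u \<noteq> []" "v \<in> lists (fst X)" "v \<noteq> []" for u v
    using that(1,2)
  proof (induction u)
    case (Cons x u)
    show ?case
    proof (cases "u = []")
      case True then show ?thesis using that by (simp add: p_def)
    next
      case False
      then have "p (u @ v) = mul A (p u) (p v)" using Cons by auto
      then show ?thesis using False Cons.hyps Cons.prems as[of "f x" "p u" "p v"] p[of u] p[of v] that fx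
        by (auto simp: p_def)
    qed
  qed simp
  have qa: "q (u @ w, y) = act A (p u) (q (w, y))"
    if "u \<in> lists (fst X)" "u \<noteq> []" "w \<in> lists (fst X)" "y \<in> snd X" for u w y
    using that(1,2)
  proof (induction u)
    case (Cons x u)
    show ?case
    proof (cases "u = []")
      case True then show ?thesis by (simp add: p_def q_def)
    next
      case False
      then have "q (u @ w, y) = act A (p u) (q (w, y))" using Cons by auto
      moreover have "act A (mul A (f x) (p u)) (q (w, y)) = act A (f x) (act A (p u) (q (w, y)))"
        using Cons.hyps False that by (intro as2) (auto intro: fx p q)
      ultimately show ?thesis using False by (simp add: p_def q_def)
    qed
  qed simp
  define \<phi> where "\<phi> = (restrict p (sgrp ?F), restrict q (pts ?F))"
  have "\<phi> \<in> Hom ?F A"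
    unfolding Hom_def \<phi>_def by (auto simp: F pm qa intro: p q)
  moreover have "\<forall>x\<in>fst X. fst \<phi> [x] = f x" "\<forall>y\<in>snd X. snd \<phi> ([], y) = g y"
    by (auto simp: \<phi>_def F p_def q_def)
  moreover have "\<psi> = \<phi>" if \<psi>: "\<psi> \<in> Hom ?F A"
    "\<forall>x\<in>fst X. fst \<psi> [x] = f x" "\<forall>y\<in>snd X. snd \<psi> ([], y) = g y" for \<psi>
  proof -
    obtain r s where rs: "\<psi> = (r, s)" by (cases \<psi>)
    have ext: "r \<in> extensional (sgrp ?F)" "s \<in> extensional (pts ?F)"
      and rm: "\<And>a b. a \<in> sgrp ?F \<Longrightarrow> b \<in> sgrp ?F \<Longrightarrow> r (mul ?F a b) = mul A (r a) (r b)"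
      and sa: "\<And>a y. a \<in> sgrp ?F \<Longrightarrow> y \<in> pts ?F \<Longrightarrow> s (act ?F a y) = act A (r a) (s y)"
      using \<psi>(1) unfolding rs Hom_def by (auto simp: PiE_def)
    have r: "r w = p w" if "w \<in> lists (fst X)" "w \<noteq> []" for w
      using that
    proof (induction w)
      case (Cons x w)
      then show ?case using rm[of "[x]" w] \<psi>(2) by (cases "w = []") (auto simp: F rs p_def)
    qed simp
    have s: "s (w, y) = q (w, y)" if "w \<in> lists (fst X)" "y \<in> snd X" for w y
    proof (cases "w = []")
      case True then show ?thesis using \<psi>(3) that by (simp add: rs q_def)
    next
      case False
      then have "s (w @ [], y) = act A (p w) (s ([], y))"
        using sa[of w "([], y)"] that r[of w] by (simp add: F)
      also have "\<dots> = q (w @ [], y)"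
        using qa[of w "[]" y] False that \<psi>(3) by (simp add: rs q_def)
      finally show ?thesis by simp
    qed
    have "r = restrict p (sgrp ?F)"
      by (rule extensionalityI[OF ext(1)]) (auto simp: F r)
    moreover have "s = restrict q (pts ?F)"
      by (rule extensionalityI[OF ext(2)]) (auto simp: F s in_lists_conv_set)
    ultimately show ?thesis by (simp add: rs \<phi>_def)
  qed
  ultimately show ?thesis by blast
qed

lemma quot_map_epi:
  assumes T: "T \<in> alg_closed H A" and A: "is_action A" and H: "is_action H"
  shows "is_action (quot_action A T)"
    and "quot_map A T \<in> Hom A (quot_action A T)"
    and "fst (quot_map A T) ` sgrp A = sgrp (quot_action A T)"
    and "snd (quot_map A T) ` pts A = pts (quot_action A T)"
proof -
  have iff: "p \<in> T \<longleftrightarrow> p \<in> sort_square A \<and> (\<forall>\<phi>\<in>Hom A H. T \<subseteq> hom_ker A \<phi> \<longrightarrow> p \<in> hom_ker A \<phi>)" for p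
    using T unfolding alg_closed_def alg_closure_def by blast
  have cl: "mul A a b \<in> sgrp A" if "a \<in> sgrp A" "b \<in> sgrp A" for a b
    using A that by (auto simp: is_action_def)
  have cl2: "act A a y \<in> pts A" if "a \<in> sgrp A" "y \<in> pts A" for a y
    using A that by (auto simp: is_action_def)
  have L: "(Inl a, v) \<in> T \<longleftrightarrow> (\<exists>a'. v = Inl a' \<and> a \<in> sgrp A \<and> a' \<in> sgrp A \<and>
      (\<forall>\<phi>\<in>Hom A H. T \<subseteq> hom_ker A \<phi> \<longrightarrow> fst \<phi> a = fst \<phi> a'))" for a v
    unfolding iff[of "(Inl a, v)"] by (auto simp: sort_square_def hom_ker_def)
  have R: "(Inr y, v) \<in> T \<longleftrightarrow> (\<exists>y'. v = Inr y' \<and> y \<in> pts A \<and> y' \<in> pts A \<and>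
      (\<forall>\<phi>\<in>Hom A H. T \<subseteq> hom_ker A \<phi> \<longrightarrow> snd \<phi> y = snd \<phi> y'))" for y v
    unfolding iff[of "(Inr y, v)"] by (auto simp: sort_square_def hom_ker_def)
  have hm: "fst \<phi> (mul A a b) = mul H (fst \<phi> a) (fst \<phi> b)"
    if "\<phi> \<in> Hom A H" "a \<in> sgrp A" "b \<in> sgrp A" for \<phi> a b
    using that by (auto simp: Hom_def)
  have ha: "snd \<phi> (act A a y) = act H (fst \<phi> a) (snd \<phi> y)"
    if "\<phi> \<in> Hom A H" "a \<in> sgrp A" "y \<in> pts A" for \<phi> a y
    using that by (auto simp: Hom_def)
  have tr: "(u, v) \<in> T \<Longrightarrow> (v, w) \<in> T \<Longrightarrow> (u, w) \<in> T" for u v w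
    by (cases u) (auto simp: L R)
  have cm: "(Inl (mul A a b), Inl (mul A a' b')) \<in> T"
    if "(Inl a, Inl a') \<in> T" "(Inl b, Inl b') \<in> T" for a b a' b'
    using that by (auto simp: L cl hm)
  have ca: "(Inr (act A a y), Inr (act A a' y')) \<in> T"
    if "(Inl a, Inl a') \<in> T" "(Inr y, Inr y') \<in> T" for a y a' y'
    using that by (auto simp: L R cl2 ha)
  have reflL: "(Inl a, Inl a) \<in> T" if "a \<in> sgrp A" for a using that by (simp add: L)
  have reflR: "(Inr y, Inr y) \<in> T" if "y \<in> pts A" for y using that by (simp add: R)
  have M: "mul (quot_action A T) (T `` {Inl a}) (T `` {Inl b}) = T `` {Inl (mul A a b)}"
    if "a \<in> sgrp A" "b \<in> sgrp A" for a b
  proof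
    show "mul (quot_action A T) (T `` {Inl a}) (T `` {Inl b}) \<subseteq> T `` {Inl (mul A a b)}"
      using cm tr unfolding quot_action_def by (simp add: subset_iff) blast
    show "T `` {Inl (mul A a b)} \<subseteq> mul (quot_action A T) (T `` {Inl a}) (T `` {Inl b})"
      using reflL that unfolding quot_action_def by auto
  qed
  have C: "act (quot_action A T) (T `` {Inl a}) (T `` {Inr y}) = T `` {Inr (act A a y)}"
    if "a \<in> sgrp A" "y \<in> pts A" for a y
  proof
    show "act (quot_action A T) (T `` {Inl a}) (T `` {Inr y}) \<subseteq> T `` {Inr (act A a y)}"
      using ca tr unfolding quot_action_def by (simp add: subset_iff) blast
    show "T `` {Inr (act A a y)} \<subseteq> act (quot_action A T) (T `` {Inl a}) (T `` {Inr y})"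
      using reflL[OF that(1)] reflR[OF that(2)] unfolding quot_action_def by (auto simp: Image_iff)
  qed
  have S: "sgrp (quot_action A T) = (\<lambda>a. T `` {Inl a}) ` sgrp A"
    "pts (quot_action A T) = (\<lambda>y. T `` {Inr y}) ` pts A"
    by (simp_all add: quot_action_def)
  have as: "mul A (mul A a b) c = mul A a (mul A b c)"
    if "a \<in> sgrp A" "b \<in> sgrp A" "c \<in> sgrp A" for a b c
    using A that by (auto simp: is_action_def)
  have as2: "act A (mul A a b) y = act A a (act A b y)"
    if "a \<in> sgrp A" "b \<in> sgrp A" "y \<in> pts A" for a b y
    using A that by (auto simp: is_action_def)
  show "is_action (quot_action A T)"
    unfolding is_action_def S by (simp add: M C cl cl2 as as2)
  show "quot_map A T \<in> Hom A (quot_action A T)"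
    unfolding Hom_def quot_map_def by (simp add: S M C cl cl2)
  show "fst (quot_map A T) ` sgrp A = sgrp (quot_action A T)"
    "snd (quot_map A T) ` pts A = pts (quot_action A T)"
    by (simp_all add: quot_map_def S)
qed

end

theory Submission
  imports Defs
begin

text \<open>
  Geometric equivalence means that both algebras have the same closed relations on every object, so
  it suffices that every automorphism \<open>\<Phi>\<close> of the category is inner.  The free objects \<open>F(x)\<close> and
  \<open>F(y)\<close> on one generator are recognised by their commutative endomorphism monoids, so \<open>\<Phi>\<close> permutes
  the objects of each of these two kinds.  As they represent the two sorts, \<open>\<Phi>\<close> yields natural
  bijections \<open>A \<rightarrow> \<Phi> A\<close>.  Along these, the operations of \<open>\<Phi> A\<close> become operations on \<open>A\<close> given by a
  word \<open>w(a, b)\<close> and by \<open>a\<^sup>k \<circ> y\<close>.  Associativity forces each letter to occur exactly once in \<open>w\<close>, and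
  the action law \<open>w(a, b)\<^sup>k = a\<^sup>k b\<^sup>k\<close> then leaves only \<open>w = ab\<close>, \<open>k = 1\<close>: the mirror image \<open>ba\<close>, which is
  possible for semigroups alone, is excluded by the action.  Hence the bijections are isomorphisms,
  and they carry a closed relation \<open>T\<close> to \<open>\<alpha>(T)\<close>.
\<close>

declare split_paired_All [simp del] split_paired_Ex [simp del]

section \<open>Closed relations\<close>

lemma alg_closure_iff:
  "p \<in> alg_closure F H T \<longleftrightarrow>
    p \<in> sort_square F \<and> (\<forall>\<phi>\<in>Hom F H. T \<subseteq> hom_ker F \<phi> \<longrightarrow> p \<in> hom_ker F \<phi>)"
  unfolding alg_closure_def by blast

lemma alg_closure_extensive: "T \<subseteq> sort_square F \<Longrightarrow> T \<subseteq> alg_closure F H T"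
  by (auto simp: alg_closure_iff)

text \<open>A closed relation is the intersection of the kernels containing it. Conversely, each
  member of \<open>P\<close> is among the homomorphisms that define the closure of the intersection,
  so closing adds nothing. Kernels, unlike closures, pull back directly along homomorphisms.\<close>

lemma alg_closed_iff:
  "T \<in> alg_closed H F \<longleftrightarrow> (\<exists>P \<subseteq> Hom F H. T = sort_square F \<inter> \<Inter>(hom_ker F ` P))"
proof
  let ?P = "{\<phi> \<in> Hom F H. T \<subseteq> hom_ker F \<phi>}"
  assume "T \<in> alg_closed H F"
  then have "p \<in> T \<longleftrightarrow> p \<in> sort_square F \<inter> \<Inter>(hom_ker F ` ?P)" for p
    using alg_closure_iff[of p F H T] unfolding alg_closed_def by blast
  then have eq: "T = sort_square F \<inter> \<Inter>(hom_ker F ` ?P)"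
    by (rule set_eqI)
  have "?P \<subseteq> Hom F H"
    by (rule Collect_restrict)
  from exI[of "\<lambda>P. P \<subseteq> Hom F H \<and> T = sort_square F \<inter> \<Inter>(hom_ker F ` P)", OF conjI[OF this eq]]
  show "\<exists>P \<subseteq> Hom F H. T = sort_square F \<inter> \<Inter>(hom_ker F ` P)" .
next
  assume "\<exists>P \<subseteq> Hom F H. T = sort_square F \<inter> \<Inter>(hom_ker F ` P)"
  then obtain P where P: "P \<subseteq> Hom F H" "T = sort_square F \<inter> \<Inter>(hom_ker F ` P)"
    by (elim exE conjE)
  have ker: "\<phi> \<in> Hom F H" "T \<subseteq> hom_ker F \<phi>" if "\<phi> \<in> P" for \<phi>
    using P that by auto
  have "p \<in> T" if "p \<in> alg_closure F H T" for p
  proof -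
    have "p \<in> hom_ker F \<phi>" if "\<phi> \<in> P" for \<phi>
      using \<open>p \<in> alg_closure F H T\<close> ker[OF that] by (simp add: alg_closure_iff)
    moreover have "p \<in> sort_square F"
      using that by (simp add: alg_closure_iff)
    ultimately show ?thesis
      by (simp add: P(2))
  qed
  moreover have "T \<subseteq> sort_square F"
    unfolding P(2) by (rule Int_lower1)
  ultimately show "T \<in> alg_closed H F"
    using alg_closure_extensive[of T F H] by (auto simp: alg_closed_def)
qed

lemma alg_closedE:
  assumes "T \<in> alg_closed H F"
  obtains P where "P \<subseteq> Hom F H" "T = sort_square F \<inter> \<Inter>(hom_ker F ` P)"
  using iffD1[OF alg_closed_iff assms] by (elim exE conjE)

text \<open>The closure is itself closed, because \<open>T\<close> and its closure lie in the same
  kernels, and by monotonicity it is the least closed relation above \<open>T\<close>. So the closed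
  relations determine the closure operator.\<close>

lemma alg_closure_eq_Inter:
  assumes "T \<subseteq> sort_square F"
  shows "alg_closure F H T = \<Inter>{S \<in> alg_closed H F. T \<subseteq> S}"
proof
  have mono: "alg_closure F H T \<subseteq> alg_closure F H S" if "T \<subseteq> S" for S
    using that by (auto simp: alg_closure_iff)
  show "alg_closure F H T \<subseteq> \<Inter>{S \<in> alg_closed H F. T \<subseteq> S}"
  proof (intro Inter_greatest)
    fix S assume "S \<in> {S \<in> alg_closed H F. T \<subseteq> S}"
    then show "alg_closure F H T \<subseteq> S"
      using mono[of S] by (simp add: alg_closed_def)
  qed
  have "alg_closure F H T \<subseteq> hom_ker F \<phi>" if "\<phi> \<in> Hom F H" "T \<subseteq> hom_ker F \<phi>" for \<phi>
    using that by (auto simp: alg_closure_iff)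
  then have "alg_closure F H (alg_closure F H T) \<subseteq> alg_closure F H T"
    unfolding subset_iff alg_closure_iff[of _ _ _ "alg_closure F H T"] alg_closure_iff[of _ _ _ T] by blast
  moreover have "alg_closure F H T \<subseteq> sort_square F"
    by (auto simp: alg_closure_iff)
  ultimately have "alg_closure F H T \<in> alg_closed H F"
    using alg_closure_extensive unfolding alg_closed_def by blast
  then show "\<Inter>{S \<in> alg_closed H F. T \<subseteq> S} \<subseteq> alg_closure F H T"
    using alg_closure_extensive[OF assms] by (intro Inter_lower) simp
qed

text \<open>A closure operator and its closed relations determine each other, so the theorem becomes
  a comparison of families of closed relations.\<close>

lemma geometrically_equivalent_iff:
  "geometrically_equivalent H1 H2 \<longleftrightarrow> (\<forall>F\<in>Ob. alg_closed H1 F = alg_closed H2 F)"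
proof
  assume "geometrically_equivalent H1 H2"
  then show "\<forall>F\<in>Ob. alg_closed H1 F = alg_closed H2 F"
    unfolding geometrically_equivalent_def alg_closed_def by auto
next
  assume "\<forall>F\<in>Ob. alg_closed H1 F = alg_closed H2 F"
  then show "geometrically_equivalent H1 H2"
    by (simp add: geometrically_equivalent_def alg_closure_eq_Inter)
qed

section \<open>Homomorphisms and inverse images of relations\<close>

lemma Hom_comp:
  assumes "is_action A" "\<phi> \<in> Hom A B" "\<psi> \<in> Hom B C"
  shows "hom_comp A \<psi> \<phi> \<in> Hom A C"
  using assms unfolding Hom_def hom_comp_def is_action_def
  by (auto simp: compose_def PiE_iff Pi_iff)

lemma Hom_mul:
  "\<phi> \<in> Hom A B \<Longrightarrow> a \<in> sgrp A \<Longrightarrow> b \<in> sgrp A \<Longrightarrow> fst \<phi> (mul A a b) = mul B (fst \<phi> a) (fst \<phi> b)"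
  by (auto simp: Hom_def)

lemma Hom_act:
  "\<phi> \<in> Hom A B \<Longrightarrow> a \<in> sgrp A \<Longrightarrow> y \<in> pts A \<Longrightarrow> snd \<phi> (act A a y) = act B (fst \<phi> a) (snd \<phi> y)"
  by (auto simp: Hom_def)

lemma hom_id_in_Hom: "is_action A \<Longrightarrow> hom_id A \<in> Hom A A"
  unfolding Hom_def hom_id_def is_action_def by auto

text \<open>The inverse image of \<open>T\<close> under \<open>\<phi>\<close> applied to both
  entries. Intersecting with \<open>sort_square A\<close> matters because the components of
  \<open>\<phi>\<close> carry no information off the carriers.\<close>

definition pullback :: "('a, 'b) sg_action \<Rightarrow> ('a \<Rightarrow> 'c) \<times> ('b \<Rightarrow> 'd) \<Rightarrow> ('c + 'd) rel \<Rightarrow> ('a + 'b) rel"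
  where "pullback A \<phi> T =
    {(u, v) \<in> sort_square A. (map_sum (fst \<phi>) (snd \<phi>) u, map_sum (fst \<phi>) (snd \<phi>) v) \<in> T}"

lemma map_sum_sort_square:
  assumes "\<phi> \<in> Hom A B" "(u, v) \<in> sort_square A"
  shows "(map_sum (fst \<phi>) (snd \<phi>) u, map_sum (fst \<phi>) (snd \<phi>) v) \<in> sort_square B"
  using assms unfolding Hom_def sort_square_def by (auto simp: PiE_iff)

lemma pullback_hom_ker:
  assumes "\<phi> \<in> Hom A B"
  shows "pullback A \<phi> (hom_ker B \<psi>) = hom_ker A (hom_comp A \<psi> \<phi>)"
proof -
  have "map_sum (fst (hom_comp A \<psi> \<phi>)) (snd (hom_comp A \<psi> \<phi>)) u
      = map_sum (fst \<psi>) (snd \<psi>) (map_sum (fst \<phi>) (snd \<phi>) u)"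
    if "(u, u) \<in> sort_square A" for u
    using that by (auto simp: sort_square_def hom_comp_def compose_def)
  moreover have "(u, u) \<in> sort_square A \<and> (v, v) \<in> sort_square A" if "(u, v) \<in> sort_square A" for u v
    using that by (auto simp: sort_square_def)
  ultimately show ?thesis
    using map_sum_sort_square[OF assms] unfolding pullback_def hom_ker_def by auto
qed

text \<open>Inverse images preserve intersections and send the kernel of \<open>\<psi>\<close> to
  that of the composite with \<open>\<phi>\<close>, so a presentation by kernels over
  \<open>B\<close> yields one over \<open>A\<close>.\<close>

lemma pullback_alg_closed:
  assumes "is_action A" "\<phi> \<in> Hom A B" "T \<in> alg_closed H B"
  shows "pullback A \<phi> T \<in> alg_closed H A"
proof -
  obtain P where P: "P \<subseteq> Hom B H" "T = sort_square B \<inter> \<Inter>(hom_ker B ` P)"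
    using assms(3) by (rule alg_closedE)
  \<comment> \<open>Since \<open>\<phi>\<close> preserves sorts, \<open>sort_square B\<close> pulls
    back to all of \<open>sort_square A\<close>; this also covers an empty \<open>P\<close>.\<close>
  have "pullback A \<phi> T = sort_square A \<inter> \<Inter>((\<lambda>\<psi>. pullback A \<phi> (hom_ker B \<psi>)) ` P)"
    using map_sum_sort_square[OF assms(2)] unfolding P(2) by (auto simp: pullback_def)
  then have "pullback A \<phi> T = sort_square A \<inter> \<Inter>(hom_ker A ` (\<lambda>\<psi>. hom_comp A \<psi> \<phi>) ` P)"
    by (simp add: pullback_hom_ker[OF assms(2)] image_image)
  moreover have "(\<lambda>\<psi>. hom_comp A \<psi> \<phi>) ` P \<subseteq> Hom A H"
    using Hom_comp[OF assms(1,2)] P(1) by blast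
  ultimately show ?thesis
    unfolding alg_closed_iff by blast
qed

text \<open>Pulling back along \<open>\<psi>\<close> and then along \<open>\<phi>\<close> is pulling
  back along the composite, which is the identity on \<open>A\<close>.\<close>

lemma pullback_pullback:
  assumes "\<phi> \<in> Hom A B" "S \<subseteq> sort_square A"
    and "\<And>a. a \<in> sgrp A \<Longrightarrow> fst \<psi> (fst \<phi> a) = a" "\<And>y. y \<in> pts A \<Longrightarrow> snd \<psi> (snd \<phi> y) = y"
  shows "pullback A \<phi> (pullback B \<psi> S) = S"
proof -
  have "map_sum (fst \<psi>) (snd \<psi>) (map_sum (fst \<phi>) (snd \<phi>) u) = u" if "(u, u) \<in> sort_square A" for u
    using that assms(3,4) by (auto simp: sort_square_def)
  moreover have "(u, u) \<in> sort_square A \<and> (v, v) \<in> sort_square A" if "(u, v) \<in> sort_square A" for u v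
    using that by (auto simp: sort_square_def)
  ultimately show ?thesis
    using map_sum_sort_square[OF assms(1)] assms(2) unfolding pullback_def by auto
qed

lemma bij_hom_inverse:
  assumes "is_action A" "\<phi> \<in> Hom A B" "bij_betw (fst \<phi>) (sgrp A) (sgrp B)" "bij_betw (snd \<phi>) (pts A) (pts B)"
  obtains \<psi> where "\<psi> \<in> Hom B A"
    "\<And>a. a \<in> sgrp A \<Longrightarrow> fst \<psi> (fst \<phi> a) = a" "\<And>y. y \<in> pts A \<Longrightarrow> snd \<psi> (snd \<phi> y) = y"
proof -
  obtain f g where \<phi>: "\<phi> = (f, g)" by fastforce
  \<comment> \<open>\<open>restrict\<close> makes the inverse extensional, as membership in
    \<open>Hom\<close> demands.\<close>
  define f' where "f' = restrict (inv_into (sgrp A) f) (sgrp B)"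
  define g' where "g' = restrict (inv_into (pts A) g) (pts B)"
  have bij: "bij_betw f (sgrp A) (sgrp B)" "bij_betw g (pts A) (pts B)"
    using assms(3,4) \<phi> by auto
  have f': "f' (f a) = a" "f a \<in> sgrp B" if "a \<in> sgrp A" for a
    using that bij(1) by (auto simp: f'_def bij_betw_def)
  have g': "g' (g a) = a" "g a \<in> pts B" if "a \<in> pts A" for a
    using that bij(2) by (auto simp: g'_def bij_betw_def)
  have B1: "\<exists>a'\<in>sgrp A. a = f a'" if "a \<in> sgrp B" for a
    using bij(1) that unfolding bij_betw_def by blast
  have B2: "\<exists>y'\<in>pts A. y = g y'" if "y \<in> pts B" for y
    using bij(2) that unfolding bij_betw_def by blast
  have cl: "mul A a b \<in> sgrp A" if "a \<in> sgrp A" "b \<in> sgrp A" for a b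
    using assms(1) that by (simp add: is_action_def)
  have cl2: "act A a y \<in> pts A" if "a \<in> sgrp A" "y \<in> pts A" for a y
    using assms(1) that by (simp add: is_action_def)
  have hom: "mul B (f a) (f b) = f (mul A a b)" if "a \<in> sgrp A" "b \<in> sgrp A" for a b
    using assms(2) that by (simp add: Hom_def \<phi>)
  have hom2: "act B (f a) (g y) = g (act A a y)" if "a \<in> sgrp A" "y \<in> pts A" for a y
    using assms(2) that by (simp add: Hom_def \<phi>)
  have "f' a \<in> sgrp A" if "a \<in> sgrp B" for a
    using B1[OF that] f' by auto
  moreover have "g' y \<in> pts A" if "y \<in> pts B" for y
    using B2[OF that] g' by auto
  ultimately have "f' \<in> sgrp B \<rightarrow>\<^sub>E sgrp A" "g' \<in> pts B \<rightarrow>\<^sub>E pts A"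
    by (simp_all add: PiE_iff) (simp_all add: f'_def g'_def)
  moreover have "f' (mul B a b) = mul A (f' a) (f' b)" if ab: "a \<in> sgrp B" "b \<in> sgrp B" for a b
  proof -
    obtain a' b' where "a' \<in> sgrp A" "a = f a'" "b' \<in> sgrp A" "b = f b'"
      using B1[OF ab(1)] B1[OF ab(2)] by blast
    then show ?thesis by (simp add: hom f' cl)
  qed
  moreover have "g' (act B a y) = act A (f' a) (g' y)" if ay: "a \<in> sgrp B" "y \<in> pts B" for a y
  proof -
    obtain a' y' where "a' \<in> sgrp A" "a = f a'" "y' \<in> pts A" "y = g y'"
      using B1[OF ay(1)] B2[OF ay(2)] by blast
    then show ?thesis by (simp add: hom2 f' g' cl2)
  qed
  ultimately have "(f', g') \<in> Hom B A"
    by (simp add: Hom_def)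
  then show thesis
    using f' g' by (intro that[of "(f', g')"]) (simp_all add: \<phi>)
qed

text \<open>Having equal images under every map in \<open>P\<close> is an equivalence. Hence
  equality of classes in the quotient can be read as membership in \<open>T\<close>.\<close>

lemma alg_closed_equiv:
  assumes "T \<in> alg_closed H A"
  shows "equiv (Inl ` sgrp A \<union> Inr ` pts A) T"
proof -
  obtain P where "P \<subseteq> Hom A H" and P: "T = sort_square A \<inter> \<Inter>(hom_ker A ` P)"
    using assms by (rule alg_closedE)
  have T: "(u, v) \<in> T \<longleftrightarrow> (u, v) \<in> sort_square A \<and>
      (\<forall>\<phi>\<in>P. map_sum (fst \<phi>) (snd \<phi>) u = map_sum (fst \<phi>) (snd \<phi>) v)" for u v
    by (auto simp: P hom_ker_def)
  show ?thesis
  proof (rule equivI)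
    show "T \<subseteq> (Inl ` sgrp A \<union> Inr ` pts A) \<times> (Inl ` sgrp A \<union> Inr ` pts A)"
      by (auto simp: P sort_square_def)
    show "refl_on (Inl ` sgrp A \<union> Inr ` pts A) T"
      by (auto simp: refl_on_def T sort_square_def)
    show "sym T"
      by (auto simp: sym_def T sort_square_def)
    show "trans T"
      by (auto simp: trans_def T sort_square_def)
  qed
qed


section \<open>Homomorphisms between free actions\<close>

lemma free_action_simps [simp]:
  "sgrp (free_action X) = lists (fst X) - {[]}"
  "pts (free_action X) = lists (fst X) \<times> snd X"
  "mul (free_action X) = (@)"
  "act (free_action X) u p = (u @ fst p, snd p)"
  by (simp_all add: free_action_def split: prod.split)

lemma free_action_Ob: "finite (fst X) \<Longrightarrow> finite (snd X) \<Longrightarrow> free_action X \<in> Ob"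
  unfolding Ob_def by blast

lemma Ob_cases:
  assumes "A \<in> Ob"
  obtains X where "A = free_action X"
  using assms unfolding Ob_def by blast

lemma Ob_is_action: "A \<in> Ob \<Longrightarrow> is_action A"
  by (auto simp: Ob_def is_action_free_action)

text \<open>The uniqueness half of \<open>free_action_universal\<close>.\<close>

lemma Hom_free_eqI:
  assumes "is_action A" "\<phi> \<in> Hom (free_action X) A" "\<psi> \<in> Hom (free_action X) A"
    and "\<And>x. x \<in> fst X \<Longrightarrow> fst \<phi> [x] = fst \<psi> [x]"
    and "\<And>y. y \<in> snd X \<Longrightarrow> snd \<phi> ([], y) = snd \<psi> ([], y)"
  shows "\<phi> = \<psi>"
proof -
  have "(\<lambda>x. fst \<phi> [x]) \<in> fst X \<rightarrow> sgrp A" "(\<lambda>y. snd \<phi> ([], y)) \<in> snd X \<rightarrow> pts A"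
    using assms(2) by (auto simp: Hom_def PiE_iff)
  note ex = free_action_universal[OF assms(1) this]
  show ?thesis
    \<comment> \<open>Both homomorphisms are the unique extension of the values of
      \<open>\<phi>\<close> on the generators.\<close>
    by (rule trans[OF sym, OF the1_equality[OF ex] the1_equality[OF ex]]) (use assms in auto)
qed

text \<open>Both composites start at a free action, so they agree as soon as they agree on
  generators, where equality of classes is membership in \<open>T\<close>. This makes the
  compatibility condition of automorphic equivalence a statement about pairs.\<close>

lemma quot_map_comp_eq_iff:
  assumes "T \<in> alg_closed H A" "is_action A" "is_action H"
    and "\<phi> \<in> Hom (free_action X) A" "\<psi> \<in> Hom (free_action X) A"
  shows "hom_comp (free_action X) (quot_map A T) \<phi> = hom_comp (free_action X) (quot_map A T) \<psi> \<longleftrightarrow>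
    (\<forall>x\<in>fst X. (Inl (fst \<phi> [x]), Inl (fst \<psi> [x])) \<in> T) \<and>
    (\<forall>y\<in>snd X. (Inr (snd \<phi> ([], y)), Inr (snd \<psi> ([], y))) \<in> T)"
proof -
  let ?q = "\<lambda>\<phi>. hom_comp (free_action X) (quot_map A T) \<phi>"
  have hom: "?q \<phi> \<in> Hom (free_action X) (quot_action A T)" "?q \<psi> \<in> Hom (free_action X) (quot_action A T)"
    using assms(4,5)[THEN Hom_comp[OF is_action_free_action _ quot_map_epi(2)[OF assms(1-3)]]] .
  have in1: "fst \<phi> [x] \<in> sgrp A" "fst \<psi> [x] \<in> sgrp A" if "x \<in> fst X" for x
    using assms(4,5) that by (auto simp: Hom_def PiE_iff)
  have in2: "snd \<phi> ([], y) \<in> pts A" "snd \<psi> ([], y) \<in> pts A" if "y \<in> snd X" for y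
    using assms(4,5) that by (auto simp: Hom_def PiE_iff)
  have eq1: "fst (?q \<phi>) [x] = fst (?q \<psi>) [x] \<longleftrightarrow> (Inl (fst \<phi> [x]), Inl (fst \<psi> [x])) \<in> T"
    if "x \<in> fst X" for x
    using that in1[OF that] eq_equiv_class_iff[OF alg_closed_equiv[OF assms(1)]]
    by (simp add: hom_comp_def compose_def quot_map_def)
  have eq2: "snd (?q \<phi>) ([], y) = snd (?q \<psi>) ([], y) \<longleftrightarrow> (Inr (snd \<phi> ([], y)), Inr (snd \<psi> ([], y))) \<in> T"
    if "y \<in> snd X" for y
    using that in2[OF that] eq_equiv_class_iff[OF alg_closed_equiv[OF assms(1)]]
    by (simp add: hom_comp_def compose_def quot_map_def)
  show ?thesis
    using Hom_free_eqI[OF quot_map_epi(1)[OF assms(1-3)] hom] eq1 eq2 by metis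
qed

section \<open>Substitutions and endomorphisms of free actions\<close>

text \<open>An explicit formula for the extension promised by \<open>free_action_universal\<close>
  when the target is free as well, so that values can be computed.\<close>

definition substitution ::
  "nat set \<times> nat set \<Rightarrow> (nat \<Rightarrow> nat list) \<Rightarrow> (nat \<Rightarrow> nat list \<times> nat) \<Rightarrow> word_hom" where
  "substitution X \<sigma> \<tau> = (\<lambda>w\<in>sgrp (free_action X). concat (map \<sigma> w),
     \<lambda>p\<in>pts (free_action X). (concat (map \<sigma> (fst p)) @ fst (\<tau> (snd p)), snd (\<tau> (snd p))))"

lemma concat_map_in_lists:
  "w \<in> lists S \<Longrightarrow> \<sigma> \<in> S \<rightarrow> lists S' - {[]} \<Longrightarrow> concat (map \<sigma> w) \<in> lists S'"
  by (induction w) auto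

lemma substitution_in_Hom:
  assumes \<sigma>: "\<sigma> \<in> fst X \<rightarrow> lists (fst Y) - {[]}" and \<tau>: "\<tau> \<in> snd X \<rightarrow> lists (fst Y) \<times> snd Y"
  shows "substitution X \<sigma> \<tau> \<in> Hom (free_action X) (free_action Y)"
proof -
  have "concat (map \<sigma> w) \<noteq> []" if "w \<in> lists (fst X)" "w \<noteq> []" for w
    using that \<sigma> by (cases w) auto
  moreover have "fst (\<tau> y) \<in> lists (fst Y)" "snd (\<tau> y) \<in> snd Y" if "y \<in> snd X" for y
    using \<tau> that by (auto simp: Pi_iff mem_Times_iff)
  ultimately show ?thesis
    using concat_map_in_lists[OF _ \<sigma>]
    unfolding Hom_def substitution_def by (simp add: PiE_iff mem_Times_iff del: concat_eq_Nil_conv in_lists_conv_set)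
qed

lemma substitution_gen [simp]:
  "x \<in> fst X \<Longrightarrow> fst (substitution X \<sigma> \<tau>) [x] = \<sigma> x"
  "y \<in> snd X \<Longrightarrow> snd (substitution X \<sigma> \<tau>) ([], y) = \<tau> y"
  by (auto simp: substitution_def)

text \<open>Two endomorphisms that collapse the generators of one sort to different generators do
  not commute, so each sort has at most one generator. If both sorts occur,
  \<open>x \<mapsto> xx\<close> and \<open>y \<mapsto> x \<circ> y\<close> do not commute: the two
  composites send \<open>y\<close> to \<open>xx \<circ> y\<close> and to
  \<open>x \<circ> y\<close>.\<close>

lemma commuting_endomorphisms:
  assumes comm: "\<And>\<mu> \<nu>. \<mu> \<in> Hom (free_action X) (free_action X) \<Longrightarrow> \<nu> \<in> Hom (free_action X) (free_action X)
      \<Longrightarrow> hom_comp (free_action X) \<mu> \<nu> = hom_comp (free_action X) \<nu> \<mu>"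
  shows "X = ({}, {}) \<or> (\<exists>x. X = ({x}, {})) \<or> (\<exists>y. X = ({}, {y}))"
proof -
  let ?F = "free_action X"
  have 1: "x = x'" if "x \<in> fst X" "x' \<in> fst X" for x x'
  proof -
    let ?\<mu> = "\<lambda>x. substitution X (\<lambda>_. [x]) (Pair [])"
    have "?\<mu> x \<in> Hom ?F ?F" "?\<mu> x' \<in> Hom ?F ?F"
      using that by (auto intro!: substitution_in_Hom)
    from comm[OF this] have "fst (hom_comp ?F (?\<mu> x) (?\<mu> x')) [x] = fst (hom_comp ?F (?\<mu> x') (?\<mu> x)) [x]"
      by simp
    then show ?thesis
      using that by (simp add: hom_comp_def compose_def)
  qed
  have 2: "y = y'" if "y \<in> snd X" "y' \<in> snd X" for y y'
  proof -
    let ?\<mu> = "\<lambda>y. substitution X (\<lambda>x. [x]) (\<lambda>_. ([], y))"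
    have "?\<mu> y \<in> Hom ?F ?F" "?\<mu> y' \<in> Hom ?F ?F"
      using that by (auto intro!: substitution_in_Hom)
    from comm[OF this]
    have "snd (hom_comp ?F (?\<mu> y) (?\<mu> y')) ([], y) = snd (hom_comp ?F (?\<mu> y') (?\<mu> y)) ([], y)"
      by simp
    then show ?thesis
      using that by (simp add: hom_comp_def compose_def)
  qed
  have 3: False if "x \<in> fst X" "y \<in> snd X" for x y
  proof -
    let ?\<mu> = "substitution X (\<lambda>x. [x, x]) (Pair [])"
    let ?\<nu> = "substitution X (\<lambda>x. [x]) (Pair [x])"
    have "?\<mu> \<in> Hom ?F ?F" "?\<nu> \<in> Hom ?F ?F"
      using that by (auto intro!: substitution_in_Hom)
    from comm[OF this]
    have "snd (hom_comp ?F ?\<mu> ?\<nu>) ([], y) = snd (hom_comp ?F ?\<nu> ?\<mu>) ([], y)"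
      by simp
    then show ?thesis
      using that by (simp add: hom_comp_def compose_def substitution_def)
  qed
  have "fst X = {} \<or> (\<exists>x. fst X = {x})" "snd X = {} \<or> (\<exists>y. snd X = {y})"
    using 1 2 by blast+
  then show ?thesis
    using 3 by (cases X) auto
qed

section \<open>Elements as arrows from the free objects on one generator\<close>

abbreviation free_word :: word_action where "free_word \<equiv> free_action ({0}, {})"
abbreviation free_point :: word_action where "free_point \<equiv> free_action ({}, {0})"

text \<open>The Yoneda arrow of an element. \<open>undefined\<close> is never evaluated, as
  \<open>free_word\<close> has no generator of the second sort.\<close>

definition word_arrow :: "nat list \<Rightarrow> word_hom" where
  "word_arrow a = substitution ({0}, {}) (\<lambda>_. a) undefined"

definition point_arrow :: "nat list \<times> nat \<Rightarrow> word_hom" where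
  "point_arrow p = substitution ({}, {0}) undefined (\<lambda>_. p)"

lemma free_word_Ob [simp]: "free_word \<in> Ob" and free_point_Ob [simp]: "free_point \<in> Ob"
  by (simp_all add: free_action_Ob)

lemma word_arrow_gen [simp]: "fst (word_arrow a) [0] = a"
  by (simp add: word_arrow_def)

lemma point_arrow_gen [simp]: "snd (point_arrow p) ([], 0) = p"
  by (simp add: point_arrow_def)

lemma word_arrow_in_Hom: "A \<in> Ob \<Longrightarrow> a \<in> sgrp A \<Longrightarrow> word_arrow a \<in> Hom free_word A"
  unfolding word_arrow_def Ob_def by (auto intro!: substitution_in_Hom)

lemma point_arrow_in_Hom: "A \<in> Ob \<Longrightarrow> p \<in> pts A \<Longrightarrow> point_arrow p \<in> Hom free_point A"
  unfolding point_arrow_def Ob_def by (auto intro!: substitution_in_Hom)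

text \<open>Naturality of the correspondence between elements and arrows: both sides send the
  generator to \<open>fst \<mu> a\<close>.\<close>

lemma hom_comp_word_arrow:
  assumes "A \<in> Ob" "B \<in> Ob" "\<mu> \<in> Hom A B" "a \<in> sgrp A"
  shows "hom_comp free_word \<mu> (word_arrow a) = word_arrow (fst \<mu> a)"
proof (rule Hom_free_eqI)
  have "fst \<mu> a \<in> sgrp B"
    using assms by (auto simp: Hom_def)
  then show "word_arrow (fst \<mu> a) \<in> Hom free_word B"
    using assms word_arrow_in_Hom by blast
  show "hom_comp free_word \<mu> (word_arrow a) \<in> Hom free_word B"
    using assms word_arrow_in_Hom Hom_comp is_action_free_action by blast
qed (use assms Ob_is_action in \<open>auto simp: hom_comp_def compose_def\<close>)

lemma hom_comp_point_arrow:
  assumes "A \<in> Ob" "B \<in> Ob" "\<mu> \<in> Hom A B" "p \<in> pts A"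
  shows "hom_comp free_point \<mu> (point_arrow p) = point_arrow (snd \<mu> p)"
proof (rule Hom_free_eqI)
  have "snd \<mu> p \<in> pts B"
    using assms by (auto simp: Hom_def)
  then show "point_arrow (snd \<mu> p) \<in> Hom free_point B"
    using assms point_arrow_in_Hom by blast
  show "hom_comp free_point \<mu> (point_arrow p) \<in> Hom free_point B"
    using assms point_arrow_in_Hom Hom_comp is_action_free_action by blast
qed (use assms Ob_is_action in \<open>auto simp: hom_comp_def compose_def\<close>)

lemma Hom_free_word_eq: "A \<in> Ob \<Longrightarrow> Hom free_word A = word_arrow ` sgrp A"
proof (intro equalityI subsetI)
  fix \<phi> assume "A \<in> Ob" and \<phi>: "\<phi> \<in> Hom free_word A"
  then have "fst \<phi> [0] \<in> sgrp A"
    by (auto simp: Hom_def PiE_iff)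
  moreover from this have "\<phi> = word_arrow (fst \<phi> [0])"
    using Hom_free_eqI[OF Ob_is_action[OF \<open>A \<in> Ob\<close>] \<phi> word_arrow_in_Hom[OF \<open>A \<in> Ob\<close>]] by simp
  ultimately show "\<phi> \<in> word_arrow ` sgrp A" by blast
qed (auto simp: word_arrow_in_Hom)

lemma Hom_free_point_eq: "A \<in> Ob \<Longrightarrow> Hom free_point A = point_arrow ` pts A"
proof (intro equalityI subsetI)
  fix \<phi> assume "A \<in> Ob" and \<phi>: "\<phi> \<in> Hom free_point A"
  then have "snd \<phi> ([], 0) \<in> pts A"
    by (auto simp: Hom_def PiE_iff)
  moreover from this have "\<phi> = point_arrow (snd \<phi> ([], 0))"
    using Hom_free_eqI[OF Ob_is_action[OF \<open>A \<in> Ob\<close>] \<phi> point_arrow_in_Hom[OF \<open>A \<in> Ob\<close>]] by simp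
  ultimately show "\<phi> \<in> point_arrow ` pts A" by blast
qed (auto simp: point_arrow_in_Hom)


section \<open>Automorphisms of the category are inner\<close>

text \<open>Substituting into a binary word is linear in letter counts. This later turns
  associativity of a derived operation into equations between numbers.\<close>

lemma count_list_concat_map:
  "w \<in> lists {0, 1::nat} \<Longrightarrow> count_list (concat (map (\<lambda>i. if i = 0 then a else b) w)) c
     = count_list w 0 * count_list a c + count_list w 1 * count_list b c"
  by (induction w) auto

lemma length_eq_count_list:
  "w \<in> lists {0, 1::nat} \<Longrightarrow> length w = count_list w 0 + count_list w 1"
  by (induction w) auto

locale free_category_automorphism =
  fixes \<Phi>o :: "word_action \<Rightarrow> word_action" and \<Phi>m :: "word_action \<Rightarrow> word_action \<Rightarrow> word_hom \<Rightarrow> word_hom"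
  assumes automorphism: "category_automorphism \<Phi>o \<Phi>m"
begin

lemmas automorphism_unfolded = automorphism[unfolded category_automorphism_def]

lemma \<Phi>o_Ob [simp]: "A \<in> Ob \<Longrightarrow> \<Phi>o A \<in> Ob"
  using bij_betwE[OF automorphism_unfolded[THEN conjunct1]] by blast

lemma \<Phi>m_bij: "A \<in> Ob \<Longrightarrow> B \<in> Ob \<Longrightarrow> bij_betw (\<Phi>m A B) (Hom A B) (Hom (\<Phi>o A) (\<Phi>o B))"
  using automorphism_unfolded[THEN conjunct2, THEN conjunct1] by blast

lemma \<Phi>m_Hom: "A \<in> Ob \<Longrightarrow> B \<in> Ob \<Longrightarrow> \<mu> \<in> Hom A B \<Longrightarrow> \<Phi>m A B \<mu> \<in> Hom (\<Phi>o A) (\<Phi>o B)"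
  using bij_betwE[OF \<Phi>m_bij] by blast

lemma \<Phi>m_id: "A \<in> Ob \<Longrightarrow> \<Phi>m A A (hom_id A) = hom_id (\<Phi>o A)"
  using automorphism_unfolded[THEN conjunct2, THEN conjunct2, THEN conjunct1] by (rule bspec)

lemma \<Phi>m_comp:
  assumes "A \<in> Ob" "B \<in> Ob" "C \<in> Ob" "\<mu> \<in> Hom A B" "\<nu> \<in> Hom B C"
  shows "\<Phi>m A C (hom_comp A \<nu> \<mu>) = hom_comp (\<Phi>o A) (\<Phi>m B C \<nu>) (\<Phi>m A B \<mu>)"
  using automorphism_unfolded[THEN conjunct2, THEN conjunct2, THEN conjunct2, THEN bspec, OF assms(1),
      THEN bspec, OF assms(2), THEN bspec, OF assms(3), THEN bspec, OF assms(4), THEN bspec, OF assms(5)] .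

section \<open>Images of the free objects on one generator\<close>

text \<open>\<open>\<Phi>\<close> maps the endomorphism monoid of \<open>A\<close> isomorphically
  onto that of its image, so commutativity carries over and limits the generators of the
  image.\<close>

lemma \<Phi>o_commuting:
  assumes "A \<in> Ob"
    and comm: "\<And>\<mu> \<nu>. \<mu> \<in> Hom A A \<Longrightarrow> \<nu> \<in> Hom A A \<Longrightarrow> hom_comp A \<mu> \<nu> = hom_comp A \<nu> \<mu>"
  shows "\<Phi>o A = free_action ({}, {}) \<or> (\<exists>x. \<Phi>o A = free_action ({x}, {})) \<or>
    (\<exists>y. \<Phi>o A = free_action ({}, {y}))"
proof -
  obtain X where X: "\<Phi>o A = free_action X"
    using Ob_cases[OF \<Phi>o_Ob[OF assms(1)]] .
  have surj: "Hom (\<Phi>o A) (\<Phi>o A) = \<Phi>m A A ` Hom A A"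
    using \<Phi>m_bij assms(1) unfolding bij_betw_def by blast
  have "hom_comp (\<Phi>o A) \<mu> \<nu> = hom_comp (\<Phi>o A) \<nu> \<mu>"
    if hom: "\<mu> \<in> Hom (\<Phi>o A) (\<Phi>o A)" "\<nu> \<in> Hom (\<Phi>o A) (\<Phi>o A)" for \<mu> \<nu>
  proof -
    obtain \<mu>' \<nu>' where "\<mu>' \<in> Hom A A" "\<nu>' \<in> Hom A A" "\<mu> = \<Phi>m A A \<mu>'" "\<nu> = \<Phi>m A A \<nu>'"
      using hom unfolding surj by blast
    then show ?thesis
      using comm[of \<mu>' \<nu>'] \<Phi>m_comp[OF assms(1) assms(1) assms(1)] by metis
  qed
  from commuting_endomorphisms[of X, OF this[unfolded X]] show ?thesis
    unfolding X by blast
qed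

text \<open>Endomorphisms of \<open>free_word\<close> raise the generator to a power, and exponents
  multiply, so they commute. The other two candidates for the image have at most one endomorphism,
  whereas \<open>free_word\<close> has several.\<close>

lemma \<Phi>o_free_word: "\<exists>x. \<Phi>o free_word = free_action ({x}, {})"
proof -
  have "hom_comp free_word (word_arrow a) (word_arrow b) = hom_comp free_word (word_arrow b) (word_arrow a)"
    if "a \<in> sgrp free_word" "b \<in> sgrp free_word" for a b
  proof -
    have "replicate (length w) 0 = w" if "w \<in> lists {0::nat}" for w
      using that by (induction w) auto
    then obtain m n where "a = replicate m 0" "b = replicate n 0"
      using \<open>a \<in> _\<close> \<open>b \<in> _\<close> by (metis DiffD1 fst_conv free_action_simps(1))
    moreover have "concat (map (\<lambda>_. replicate k 0) (replicate l 0)) = replicate (l * k) (0::nat)" for k l :: nat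
      by (induction l) (auto simp: replicate_add)
    ultimately have "fst (word_arrow a) b = fst (word_arrow b) a"
      using that by (simp add: word_arrow_def substitution_def mult.commute)
    then show ?thesis
      using that by (simp only: hom_comp_word_arrow[OF free_word_Ob free_word_Ob word_arrow_in_Hom[OF free_word_Ob]])
  qed
  then have "\<Phi>o free_word = free_action ({}, {}) \<or> (\<exists>x. \<Phi>o free_word = free_action ({x}, {})) \<or>
    (\<exists>y. \<Phi>o free_word = free_action ({}, {y}))"
    by (intro \<Phi>o_commuting) (auto simp: Hom_free_word_eq simp del: free_action_simps)
  \<comment> \<open>The choices \<open>T = {}\<close> and \<open>T = {y}\<close> exclude both
    unwanted alternatives at once.\<close>
  moreover have "\<Phi>o free_word \<noteq> free_action (S, T)" if "S = {}" "T \<subseteq> {y}" for S T y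
  proof
    assume eq: "\<Phi>o free_word = free_action (S, T)"
    have "\<mu> = \<nu>" if "\<mu> \<in> Hom (\<Phi>o free_word) (\<Phi>o free_word)" "\<nu> \<in> Hom (\<Phi>o free_word) (\<Phi>o free_word)" for \<mu> \<nu>
    proof (rule Hom_free_eqI)
      fix z assume "z \<in> snd (S, T)"
      then have "snd \<mu> ([], z) \<in> {[]} \<times> T" "snd \<nu> ([], z) \<in> {[]} \<times> T"
        using that \<open>S = {}\<close> unfolding eq by (auto simp: Hom_def PiE_iff)
      then have "snd \<mu> ([], z) \<in> {([], y)}" "snd \<nu> ([], z) \<in> {([], y)}"
        using \<open>T \<subseteq> {y}\<close> by blast+
      then show "snd \<mu> ([], z) = snd \<nu> ([], z)" by simp
    qed (use that eq \<open>S = {}\<close> is_action_free_action in auto)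
    moreover have "\<Phi>m free_word free_word (word_arrow [0]) \<noteq> \<Phi>m free_word free_word (word_arrow [0, 0])"
    proof
      assume "\<Phi>m free_word free_word (word_arrow [0]) = \<Phi>m free_word free_word (word_arrow [0, 0])"
      moreover have "word_arrow [0] \<in> Hom free_word free_word" "word_arrow [0, 0] \<in> Hom free_word free_word"
        by (simp_all add: word_arrow_in_Hom)
      ultimately have "word_arrow [0] = word_arrow [0, 0]"
        using \<Phi>m_bij[of free_word free_word] by (auto simp: bij_betw_def dest: inj_onD)
      then have "fst (word_arrow [0]) [0] = fst (word_arrow [0, 0]) [0]" by metis
      then show False by simp
    qed
    ultimately show False
      by (simp add: \<Phi>m_Hom word_arrow_in_Hom)
  qed
  ultimately show ?thesis
    by (metis empty_subsetI order_refl)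
qed

text \<open>The only endomorphism of \<open>free_point\<close> is the identity, which rules out an
  image with one letter. The empty action has a single endomorphism too and is excluded by its
  arrows into other objects.\<close>

lemma \<Phi>o_free_point: "\<exists>y. \<Phi>o free_point = free_action ({}, {y})"
proof -
  have end_unique: "\<mu> = point_arrow ([], 0)" if "\<mu> \<in> Hom free_point free_point" for \<mu>
    using that by (auto simp: Hom_free_point_eq)
  then have "\<Phi>o free_point = free_action ({}, {}) \<or> (\<exists>x. \<Phi>o free_point = free_action ({x}, {})) \<or>
    (\<exists>y. \<Phi>o free_point = free_action ({}, {y}))"
    by (intro \<Phi>o_commuting) (simp, metis)
  moreover have "\<Phi>o free_point \<noteq> free_action ({}, {})"
  proof
    let ?E = "free_action ({}, {})"
    assume eq: "\<Phi>o free_point = ?E"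
    have "?E \<in> Ob" by (simp add: free_action_Ob)
    obtain X where X: "\<Phi>o ?E = free_action X"
      using Ob_cases[OF \<Phi>o_Ob[OF \<open>?E \<in> Ob\<close>]] .
    \<comment> \<open>The empty action has an arrow into every object, here into the image of
      \<open>?E\<close>. Pulled back through \<open>\<Phi>\<close> it would be an arrow from
      \<open>free_point\<close> to an action without points.\<close>
    have "substitution ({}, {}) undefined undefined \<in> Hom (\<Phi>o free_point) (\<Phi>o ?E)"
      unfolding eq X by (intro substitution_in_Hom) auto
    then have "Hom free_point ?E \<noteq> {}"
      using \<Phi>m_bij[OF free_point_Ob \<open>?E \<in> Ob\<close>] by (auto simp: bij_betw_def)
    then show False
      using \<open>?E \<in> Ob\<close> by (simp add: Hom_free_point_eq)
  qed
  moreover have "\<Phi>o free_point \<noteq> free_action ({x}, {})" for x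
  proof
    assume eq: "\<Phi>o free_point = free_action ({x}, {})"
    let ?\<mu> = "\<lambda>a. substitution ({x}, {}) (\<lambda>_. a) undefined"
    have "?\<mu> [x] \<in> Hom (\<Phi>o free_point) (\<Phi>o free_point)" "?\<mu> [x, x] \<in> Hom (\<Phi>o free_point) (\<Phi>o free_point)"
      unfolding eq by (auto intro!: substitution_in_Hom)
    moreover have "\<mu> = \<Phi>m free_point free_point (point_arrow ([], 0))"
      if "\<mu> \<in> Hom (\<Phi>o free_point) (\<Phi>o free_point)" for \<mu>
      using that end_unique \<Phi>m_bij[OF free_point_Ob free_point_Ob] unfolding bij_betw_def by blast
    ultimately have "?\<mu> [x] = ?\<mu> [x, x]" by metis
    then have "fst (?\<mu> [x]) [x] = fst (?\<mu> [x, x]) [x]" by metis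
    then show False by simp
  qed
  ultimately show ?thesis by blast
qed

section \<open>Transport of elements along the automorphism\<close>

text \<open>\<open>\<Phi>\<close> may rename the generator of a one-generator object; the new name
  is fixed here by choice.\<close>

definition letter :: nat where "letter = (SOME x. \<Phi>o free_word = free_action ({x}, {}))"
definition base :: nat where "base = (SOME y. \<Phi>o free_point = free_action ({}, {y}))"

lemma \<Phi>o_letter: "\<Phi>o free_word = free_action ({letter}, {})"
  unfolding letter_def using someI_ex[OF \<Phi>o_free_word] .

lemma \<Phi>o_base: "\<Phi>o free_point = free_action ({}, {base})"
  unfolding base_def using someI_ex[OF \<Phi>o_free_point] .

text \<open>
  Elements of \<open>A\<close> correspond to arrows from the free objects on one generator, so \<open>\<Phi>\<close> moves the
  elements of \<open>A\<close> to those of \<open>\<Phi> A\<close>.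
\<close>

definition word_map :: "word_action \<Rightarrow> nat list \<Rightarrow> nat list" where
  "word_map A a = fst (\<Phi>m free_word A (word_arrow a)) [letter]"

definition point_map :: "word_action \<Rightarrow> nat list \<times> nat \<Rightarrow> nat list \<times> nat" where
  "point_map A p = snd (\<Phi>m free_point A (point_arrow p)) ([], base)"

text \<open>The arrow of \<open>fst \<mu> a\<close> is the composite of \<open>\<mu>\<close> with
  the arrow of \<open>a\<close>; functoriality of \<open>\<Phi>\<close>, evaluated at the generator,
  gives the claim.\<close>

lemma word_map_natural:
  assumes "A \<in> Ob" "B \<in> Ob" "\<mu> \<in> Hom A B" "a \<in> sgrp A"
  shows "word_map B (fst \<mu> a) = fst (\<Phi>m A B \<mu>) (word_map A a)"
proof -
  have "\<Phi>m free_word B (word_arrow (fst \<mu> a)) = hom_comp (\<Phi>o free_word) (\<Phi>m A B \<mu>) (\<Phi>m free_word A (word_arrow a))"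
    using assms by (simp add: hom_comp_word_arrow[symmetric] \<Phi>m_comp word_arrow_in_Hom)
  then show ?thesis
    by (simp add: word_map_def \<Phi>o_letter hom_comp_def compose_def)
qed

lemma point_map_natural:
  assumes "A \<in> Ob" "B \<in> Ob" "\<mu> \<in> Hom A B" "p \<in> pts A"
  shows "point_map B (snd \<mu> p) = snd (\<Phi>m A B \<mu>) (point_map A p)"
proof -
  have "\<Phi>m free_point B (point_arrow (snd \<mu> p)) = hom_comp (\<Phi>o free_point) (\<Phi>m A B \<mu>) (\<Phi>m free_point A (point_arrow p))"
    using assms by (simp add: hom_comp_point_arrow[symmetric] \<Phi>m_comp point_arrow_in_Hom)
  then show ?thesis
    by (simp add: point_map_def \<Phi>o_base hom_comp_def compose_def)
qed

text \<open>A chain of three bijections: elements of \<open>A\<close>, arrows from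
  \<open>free_word\<close> to \<open>A\<close>, their images under \<open>\<Phi>\<close>, elements
  of \<open>\<Phi>o A\<close>.\<close>

lemma word_map_bij:
  assumes "A \<in> Ob"
  shows "bij_betw (word_map A) (sgrp A) (sgrp (\<Phi>o A))"
proof -
  let ?f = "\<Phi>m free_word A"
  have 1: "bij_betw word_arrow (sgrp A) (Hom free_word A)"
    unfolding bij_betw_def Hom_free_word_eq[OF assms] by (metis inj_onI word_arrow_gen)
  have 2: "bij_betw ?f (Hom free_word A) (Hom (free_action ({letter}, {})) (\<Phi>o A))"
    using \<Phi>m_bij[OF free_word_Ob assms] by (simp add: \<Phi>o_letter)
  \<comment> \<open>Representability again, now with the generator \<open>letter\<close> in place of
    \<open>0\<close>.\<close>
  have 3: "bij_betw (\<lambda>\<phi>. fst \<phi> [letter]) (Hom (free_action ({letter}, {})) (\<Phi>o A)) (sgrp (\<Phi>o A))"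
  proof (rule bij_betw_byWitness[where f' = "\<lambda>a. substitution ({letter}, {}) (\<lambda>_. a) undefined"])
    obtain Y where Y: "\<Phi>o A = free_action Y" using Ob_cases[OF \<Phi>o_Ob[OF assms]] .
    have sub: "substitution ({letter}, {}) (\<lambda>_. a) undefined \<in> Hom (free_action ({letter}, {})) (\<Phi>o A)"
      if "a \<in> sgrp (\<Phi>o A)" for a
      using that unfolding Y by (intro substitution_in_Hom) auto
    then show "(\<lambda>a. substitution ({letter}, {}) (\<lambda>_. a) undefined) ` sgrp (\<Phi>o A)
        \<subseteq> Hom (free_action ({letter}, {})) (\<Phi>o A)" by auto
    show in1: "(\<lambda>\<phi>. fst \<phi> [letter]) ` Hom (free_action ({letter}, {})) (\<Phi>o A) \<subseteq> sgrp (\<Phi>o A)"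
      by (auto simp: Hom_def PiE_iff)
    show "\<forall>\<phi>\<in>Hom (free_action ({letter}, {})) (\<Phi>o A).
        substitution ({letter}, {}) (\<lambda>_. fst \<phi> [letter]) undefined = \<phi>"
    proof
      fix \<phi> assume \<phi>: "\<phi> \<in> Hom (free_action ({letter}, {})) (\<Phi>o A)"
      then have "fst \<phi> [letter] \<in> sgrp (\<Phi>o A)" using in1 by blast
      from Hom_free_eqI[OF _ sub[OF this] \<phi>] show "substitution ({letter}, {}) (\<lambda>_. fst \<phi> [letter]) undefined = \<phi>"
        using assms by (simp add: Ob_is_action)
    qed
  qed simp
  show ?thesis
    using bij_betw_trans[OF bij_betw_trans[OF 1 2] 3] by (simp add: word_map_def[abs_def] comp_def)
qed

lemma point_map_bij:
  assumes "A \<in> Ob"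
  shows "bij_betw (point_map A) (pts A) (pts (\<Phi>o A))"
proof -
  let ?f = "\<Phi>m free_point A"
  have 1: "bij_betw point_arrow (pts A) (Hom free_point A)"
    unfolding bij_betw_def Hom_free_point_eq[OF assms] by (metis inj_onI point_arrow_gen)
  have 2: "bij_betw ?f (Hom free_point A) (Hom (free_action ({}, {base})) (\<Phi>o A))"
    using \<Phi>m_bij[OF free_point_Ob assms] by (simp add: \<Phi>o_base)
  have 3: "bij_betw (\<lambda>\<phi>. snd \<phi> ([], base)) (Hom (free_action ({}, {base})) (\<Phi>o A)) (pts (\<Phi>o A))"
  proof (rule bij_betw_byWitness[where f' = "\<lambda>p. substitution ({}, {base}) undefined (\<lambda>_. p)"])
    obtain Y where Y: "\<Phi>o A = free_action Y" using Ob_cases[OF \<Phi>o_Ob[OF assms]] .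
    have sub: "substitution ({}, {base}) undefined (\<lambda>_. p) \<in> Hom (free_action ({}, {base})) (\<Phi>o A)"
      if "p \<in> pts (\<Phi>o A)" for p
      using that unfolding Y by (intro substitution_in_Hom) auto
    then show "(\<lambda>p. substitution ({}, {base}) undefined (\<lambda>_. p)) ` pts (\<Phi>o A)
        \<subseteq> Hom (free_action ({}, {base})) (\<Phi>o A)" by auto
    show in1: "(\<lambda>\<phi>. snd \<phi> ([], base)) ` Hom (free_action ({}, {base})) (\<Phi>o A) \<subseteq> pts (\<Phi>o A)"
      by (auto simp: Hom_def PiE_iff)
    show "\<forall>\<phi>\<in>Hom (free_action ({}, {base})) (\<Phi>o A).
        substitution ({}, {base}) undefined (\<lambda>_. snd \<phi> ([], base)) = \<phi>"
    proof
      fix \<phi> assume \<phi>: "\<phi> \<in> Hom (free_action ({}, {base})) (\<Phi>o A)"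
      then have "snd \<phi> ([], base) \<in> pts (\<Phi>o A)" using in1 by blast
      from Hom_free_eqI[OF _ sub[OF this] \<phi>] show "substitution ({}, {base}) undefined (\<lambda>_. snd \<phi> ([], base)) = \<phi>"
        using assms by (simp add: Ob_is_action)
    qed
  qed simp
  show ?thesis
    using bij_betw_trans[OF bij_betw_trans[OF 1 2] 3] by (simp add: point_map_def[abs_def] comp_def)
qed

lemma word_map_inj: "A \<in> Ob \<Longrightarrow> a \<in> sgrp A \<Longrightarrow> b \<in> sgrp A \<Longrightarrow> word_map A a = word_map A b \<Longrightarrow> a = b"
  using word_map_bij by (auto simp: bij_betw_def dest: inj_onD)

lemma point_map_inj: "A \<in> Ob \<Longrightarrow> p \<in> pts A \<Longrightarrow> q \<in> pts A \<Longrightarrow> point_map A p = point_map A q \<Longrightarrow> p = q"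
  using point_map_bij by (auto simp: bij_betw_def dest: inj_onD)

lemma word_map_surj: "A \<in> Ob \<Longrightarrow> c \<in> sgrp (\<Phi>o A) \<Longrightarrow> \<exists>a\<in>sgrp A. word_map A a = c"
  by (metis bij_betw_imp_surj_on imageE word_map_bij)

lemma point_map_surj: "A \<in> Ob \<Longrightarrow> q \<in> pts (\<Phi>o A) \<Longrightarrow> \<exists>p\<in>pts A. point_map A p = q"
  by (metis bij_betw_imp_surj_on imageE point_map_bij)

lemma word_map_in: "A \<in> Ob \<Longrightarrow> a \<in> sgrp A \<Longrightarrow> word_map A a \<in> sgrp (\<Phi>o A)"
  using word_map_bij bij_betwE by metis

lemma point_map_in: "A \<in> Ob \<Longrightarrow> p \<in> pts A \<Longrightarrow> point_map A p \<in> pts (\<Phi>o A)"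
  using point_map_bij bij_betwE by metis

section \<open>The operations of the image as derived operations\<close>

text \<open>In the image of the free object on two letters, the product of the transported
  generators is the transport of some word \<open>w\<close>. Naturality along the substitution of
  \<open>a\<close> and \<open>b\<close> for the letters carries this one identity to every
  \<open>A\<close>.\<close>

lemma derived_mul:
  obtains w where "w \<in> lists {0, 1::nat}"
    "\<And>A a b. A \<in> Ob \<Longrightarrow> a \<in> sgrp A \<Longrightarrow> b \<in> sgrp A \<Longrightarrow>
       word_map A (concat (map (\<lambda>i. if i = 0 then a else b) w)) = word_map A a @ word_map A b"
proof -
  let ?D = "free_action ({0, 1}, {})"
  have D: "?D \<in> Ob" by (simp add: free_action_Ob)
  have gens: "[0] \<in> sgrp ?D" "[1] \<in> sgrp ?D" by auto
  obtain Y where Y: "\<Phi>o ?D = free_action Y" using Ob_cases[OF \<Phi>o_Ob[OF D]] .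
  have "word_map ?D [0] @ word_map ?D [1] \<in> sgrp (\<Phi>o ?D)"
    using word_map_in[OF D, of "[0]"] word_map_in[OF D, of "[1]"] unfolding Y by auto
  then obtain w where w: "w \<in> sgrp ?D" "word_map ?D w = word_map ?D [0] @ word_map ?D [1]"
    using word_map_surj[OF D] by blast
  have "word_map A (concat (map (\<lambda>i. if i = 0 then a else b) w)) = word_map A a @ word_map A b"
    if A: "A \<in> Ob" "a \<in> sgrp A" "b \<in> sgrp A" for A a b
  proof -
    let ?\<mu> = "substitution ({0, 1}, {}) (\<lambda>i. if i = 0 then a else b) undefined"
    have \<mu>: "?\<mu> \<in> Hom ?D A"
      using A by (auto simp: Ob_def intro!: substitution_in_Hom)
    obtain Z where Z: "\<Phi>o A = free_action Z" using Ob_cases[OF \<Phi>o_Ob[OF A(1)]] .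
    have "word_map A (concat (map (\<lambda>i. if i = 0 then a else b) w)) = word_map A (fst ?\<mu> w)"
      using w(1) by (simp add: substitution_def)
    also have "\<dots> = fst (\<Phi>m ?D A ?\<mu>) (word_map ?D [0] @ word_map ?D [1])"
      using word_map_natural[OF D A(1) \<mu> w(1)] w(2) by simp
    also have "\<dots> = fst (\<Phi>m ?D A ?\<mu>) (word_map ?D [0]) @ fst (\<Phi>m ?D A ?\<mu>) (word_map ?D [1])"
      using Hom_mul[OF \<Phi>m_Hom[OF D A(1) \<mu>] word_map_in[OF D gens(1)] word_map_in[OF D gens(2)]]
      by (simp only: Y Z free_action_simps)
    also have "\<dots> = word_map A a @ word_map A b"
      using word_map_natural[OF D A(1) \<mu>, of "[0]"] word_map_natural[OF D A(1) \<mu>, of "[1]"] by simp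
    finally show ?thesis .
  qed
  then show thesis
    using that[of w] w(1) by auto
qed

text \<open>The same argument with one letter and one point. The resulting element consists of a
  power of the single letter and the point, so only its exponent \<open>k\<close> survives;
  \<open>k = 0\<close> is not yet excluded.\<close>

lemma derived_act:
  obtains k where
    "\<And>A a p. A \<in> Ob \<Longrightarrow> a \<in> sgrp A \<Longrightarrow> p \<in> pts A \<Longrightarrow>
       point_map A (concat (replicate k a) @ fst p, snd p)
         = (word_map A a @ fst (point_map A p), snd (point_map A p))"
proof -
  let ?E = "free_action ({0}, {0})"
  have E: "?E \<in> Ob" by (simp add: free_action_Ob)
  obtain Y where Y: "\<Phi>o ?E = free_action Y" using Ob_cases[OF \<Phi>o_Ob[OF E]] .
  have "act (\<Phi>o ?E) (word_map ?E [0]) (point_map ?E ([], 0)) \<in> pts (\<Phi>o ?E)"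
    using word_map_in[OF E, of "[0]"] point_map_in[OF E, of "([], 0)"] unfolding Y by auto
  then obtain v where v: "v \<in> pts ?E" "point_map ?E v = act (\<Phi>o ?E) (word_map ?E [0]) (point_map ?E ([], 0))"
    using point_map_surj[OF E] by blast
  have "point_map A (concat (replicate (length (fst v)) a) @ fst p, snd p)
      = (word_map A a @ fst (point_map A p), snd (point_map A p))"
    if A: "A \<in> Ob" "a \<in> sgrp A" "p \<in> pts A" for A a p
  proof -
    let ?\<mu> = "substitution ({0}, {0}) (\<lambda>_. a) (\<lambda>_. p)"
    have \<mu>: "?\<mu> \<in> Hom ?E A"
      using A by (auto simp: Ob_def intro!: substitution_in_Hom)
    obtain Z where Z: "\<Phi>o A = free_action Z" using Ob_cases[OF \<Phi>o_Ob[OF A(1)]] .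
    have "point_map A (concat (replicate (length (fst v)) a) @ fst p, snd p) = point_map A (snd ?\<mu> v)"
      using v(1) by (auto simp: substitution_def map_replicate_const)
    also have "\<dots> = snd (\<Phi>m ?E A ?\<mu>) (act (\<Phi>o ?E) (word_map ?E [0]) (point_map ?E ([], 0)))"
      using point_map_natural[OF E A(1) \<mu> v(1)] v(2) by simp
    also have "\<dots> = act (\<Phi>o A) (fst (\<Phi>m ?E A ?\<mu>) (word_map ?E [0])) (snd (\<Phi>m ?E A ?\<mu>) (point_map ?E ([], 0)))"
      using Hom_act[OF \<Phi>m_Hom[OF E A(1) \<mu>] word_map_in[OF E, of "[0]"] point_map_in[OF E, of "([], 0)"]]
      by simp
    also have "\<dots> = act (\<Phi>o A) (word_map A a) (point_map A p)"
      using word_map_natural[OF E A(1) \<mu>, of "[0]"] point_map_natural[OF E A(1) \<mu>, of "([], 0)"] by simp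
    finally show ?thesis by (simp add: Z)
  qed
  then show thesis by (rule that)
qed

text \<open>The arrow of the generator is the identity, which \<open>\<Phi>\<close>
  preserves.\<close>

lemma word_map_letter: "word_map free_word [0] = [letter]"
proof -
  have "word_arrow [0] = hom_id free_word"
    using word_arrow_in_Hom[of free_word "[0]"] hom_id_in_Hom[OF is_action_free_action, of "({0}, {})"]
    by (intro Hom_free_eqI[of free_word]) (auto simp: is_action_free_action, simp add: hom_id_def)
  then show ?thesis
    unfolding word_map_def using \<Phi>m_id[OF free_word_Ob] by (simp add: hom_id_def \<Phi>o_letter)
qed

text \<open>The two claims are proved together because the order of the letters in \<open>w\<close>
  is settled only by the action law, which involves \<open>k\<close>.\<close>

lemma
  shows word_map_mul: "\<And>A a b. A \<in> Ob \<Longrightarrow> a \<in> sgrp A \<Longrightarrow> b \<in> sgrp A \<Longrightarrow>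
      word_map A (a @ b) = word_map A a @ word_map A b"
    and point_map_act: "\<And>A a p. A \<in> Ob \<Longrightarrow> a \<in> sgrp A \<Longrightarrow> p \<in> pts A \<Longrightarrow>
      point_map A (a @ fst p, snd p) = (word_map A a @ fst (point_map A p), snd (point_map A p))"
proof -
  obtain w where w: "w \<in> lists {0, 1::nat}" and
    mul: "\<And>A a b. A \<in> Ob \<Longrightarrow> a \<in> sgrp A \<Longrightarrow> b \<in> sgrp A \<Longrightarrow>
       word_map A (concat (map (\<lambda>i. if i = 0 then a else b) w)) = word_map A a @ word_map A b"
    using derived_mul by metis
  obtain k where
    act: "\<And>A a p. A \<in> Ob \<Longrightarrow> a \<in> sgrp A \<Longrightarrow> p \<in> pts A \<Longrightarrow>
       point_map A (concat (replicate k a) @ fst p, snd p)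
         = (word_map A a @ fst (point_map A p), snd (point_map A p))"
    using derived_act by metis
  \<comment> \<open>The multiplication of the image, carried back to \<open>A\<close>.\<close>
  define star where "star a b = concat (map (\<lambda>i. if i = 0 then a else b) w)" for a b :: "nat list"
  \<comment> \<open>For empty \<open>w\<close> the left side of \<open>mul\<close> would not depend
    on the factors; cancelling would identify the transports of \<open>[0, 0]\<close> and
    \<open>[0]\<close>.\<close>
  have w_ne: "w \<noteq> []"
  proof
    assume "w = []"
    then have "word_map free_word [0, 0] @ word_map free_word [0] = word_map free_word [0] @ word_map free_word [0]"
      using mul[of free_word "[0, 0]" "[0]"] mul[of free_word "[0]" "[0]"] by simp
    then show False
      using word_map_inj[of free_word "[0, 0]" "[0]"] by simp
  qed
  have star_in: "star a b \<in> sgrp A" if A: "A \<in> Ob" "a \<in> sgrp A" "b \<in> sgrp A" for A a b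
  proof -
    obtain X where X: "A = free_action X" using Ob_cases[OF A(1)] .
    have "star a b \<in> lists (fst X)"
      unfolding star_def using A X by (intro concat_map_in_lists[of w UNIV]) auto
    moreover have "star a b \<noteq> []"
      using w_ne A X unfolding star_def by (cases w) auto
    ultimately show ?thesis by (simp add: X)
  qed
  let ?D = "free_action ({0, 1}, {0})"
  have D: "?D \<in> Ob" by (simp add: free_action_Ob)
  have gens: "[0] \<in> sgrp ?D" "[1] \<in> sgrp ?D" by auto
  \<comment> \<open>Both sides are transported to the same threefold concatenation, and
    \<open>word_map\<close> is injective.\<close>
  have assoc: "star (star a b) c = star a (star b c)" if "a \<in> sgrp ?D" "b \<in> sgrp ?D" "c \<in> sgrp ?D" for a b c
  proof (rule word_map_inj[OF D])
    show "star (star a b) c \<in> sgrp ?D" "star a (star b c) \<in> sgrp ?D"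
      by (intro star_in[OF D] that)+
    show "word_map ?D (star (star a b) c) = word_map ?D (star a (star b c))"
      by (simp only: mul[OF D, folded star_def] star_in[OF D] that append_assoc)
  qed
  have count: "count_list (star a b) c = count_list w 0 * count_list a c + count_list w 1 * count_list b c" for a b c
    unfolding star_def by (rule count_list_concat_map[OF w])
  \<comment> \<open>Counting \<open>0\<close> in the associativity law for \<open>0, 1, 1\<close>,
    and below counting \<open>1\<close> for \<open>0, 0, 1\<close>, shows that each letter count of
    \<open>w\<close> is idempotent, hence at most 1.\<close>
  have "count_list w 0 * count_list w 0 = count_list w 0"
    using arg_cong[OF assoc[of "[0]" "[1]" "[1]"], of "\<lambda>u. count_list u 0"] by (simp add: count)
  moreover have "count_list w 1 * count_list w 1 = count_list w 1"
    using arg_cong[OF assoc[of "[0]" "[0]" "[1]"], of "\<lambda>u. count_list u 1"] by (auto simp: count)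
  \<comment> \<open>A one-letter \<open>w\<close> would make \<open>star\<close> a projection, so
    \<open>[letter]\<close> would equal its own square.\<close>
  moreover have "length w \<noteq> 1"
  proof
    assume "length w = 1"
    then have "star [0] [0] = [0]" by (auto simp: star_def length_Suc_conv)
    then show False
      using mul[of free_word "[0]" "[0]", folded star_def] by (simp add: word_map_letter)
  qed
  ultimately have counts: "count_list w 0 = 1" "count_list w 1 = 1"
    using w_ne length_eq_count_list[OF w] by auto
  then have "length w = 2"
    using length_eq_count_list[OF w] by simp
  then obtain i j where ij: "w = [i, j]"
    by (auto simp: numeral_2_eq_2 length_Suc_conv)
  have w_cases: "w = [0, 1] \<or> w = [1, 0]"
    using w counts unfolding ij by (auto split: if_splits)
  \<comment> \<open>The action law for the product of the two generators, read back through
    \<open>point_map\<close>: acting by \<open>star [0] [1]\<close> is acting by \<open>[1]\<close>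
    and then by \<open>[0]\<close>.\<close>
  have power: "concat (replicate k (star [0] [1])) = concat (replicate k [0]) @ concat (replicate k [1])"
  proof -
    let ?p = "([], 0) :: nat list \<times> nat"
    let ?q = "(concat (replicate k [1]), 0) :: nat list \<times> nat"
    have p: "?p \<in> pts ?D" "?q \<in> pts ?D" by auto
    have in3: "(concat (replicate k (star [0] [1])), 0) \<in> pts ?D"
      using star_in[OF D gens] by (auto simp: in_lists_conv_set)
    have "point_map ?D (concat (replicate k (star [0] [1])), 0)
        = (word_map ?D [0] @ word_map ?D [1] @ fst (point_map ?D ?p), snd (point_map ?D ?p))"
      using act[OF D star_in[OF D gens] p(1)] mul[OF D gens, folded star_def] by simp
    also have "\<dots> = point_map ?D (concat (replicate k [0]) @ concat (replicate k [1]), 0)"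
      using act[OF D gens(1) p(2)] act[OF D gens(2) p(1)] by simp
    finally have eq: "point_map ?D (concat (replicate k (star [0] [1])), 0)
        = point_map ?D (concat (replicate k [0]) @ concat (replicate k [1]), 0)" .
    have "(concat (replicate k [0]) @ concat (replicate k [1]), 0) \<in> pts ?D"
      by auto
    from point_map_inj[OF D in3 this eq] show ?thesis by (rule Pair_inject)
  qed
  \<comment> \<open>With \<open>k = 0\<close> the transported letter would fix a point of a free
    action, forcing it to be the empty word.\<close>
  have "k \<noteq> 0"
  proof
    assume "k = 0"
    then have "point_map ?D ([], 0) = (word_map ?D [0] @ fst (point_map ?D ([], 0)), snd (point_map ?D ([], 0)))"
      using act[OF D gens(1), of "([], 0)"] by simp
    from arg_cong[OF this, of fst] have "word_map ?D [0] = []"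
      by simp
    moreover obtain Y where "\<Phi>o ?D = free_action Y" using Ob_cases[OF \<Phi>o_Ob[OF D]] .
    ultimately show False
      using word_map_in[OF D gens(1)] by simp
  qed
  then obtain l where l: "k = Suc l" using not0_implies_Suc by blast
  \<comment> \<open>For \<open>w = [1, 0]\<close> the left side of \<open>power\<close> starts with
    \<open>1\<close>, but the right side starts with \<open>0\<close>.\<close>
  have w01: "w = [0, 1]"
    using w_cases power by (auto simp: star_def l)
  \<comment> \<open>For \<open>k > 1\<close> the left side of \<open>power\<close> starts with
    \<open>0, 1\<close> and the right side with \<open>0, 0\<close>.\<close>
  moreover have "l = 0"
    using power by (cases l) (auto simp: star_def l w01)
  ultimately have k: "k = 1" and star: "\<And>a b. star a b = a @ b"
    using l by (simp_all add: star_def)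
  show "word_map A (a @ b) = word_map A a @ word_map A b"
    if "A \<in> Ob" "a \<in> sgrp A" "b \<in> sgrp A" for A a b
    using mul[OF that, folded star_def] by (simp add: star)
  show "point_map A (a @ fst p, snd p) = (word_map A a @ fst (point_map A p), snd (point_map A p))"
    if "A \<in> Ob" "a \<in> sgrp A" "p \<in> pts A" for A a p
    using act[OF that] by (simp add: k)
qed

text \<open>The component at \<open>A\<close> of the natural isomorphism from the identity functor
  to \<open>\<Phi>\<close>; restriction makes it extensional.\<close>

definition component :: "word_action \<Rightarrow> word_hom" where
  "component A = (restrict (word_map A) (sgrp A), restrict (point_map A) (pts A))"

lemma component_bij:
  assumes "A \<in> Ob"
  shows "bij_betw (fst (component A)) (sgrp A) (sgrp (\<Phi>o A))" "bij_betw (snd (component A)) (pts A) (pts (\<Phi>o A))"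
  using word_map_bij[OF assms] point_map_bij[OF assms] by (simp_all add: component_def)

lemma component_in_Hom:
  assumes "A \<in> Ob"
  shows "component A \<in> Hom A (\<Phi>o A)"
proof -
  obtain X where X: "A = free_action X" using Ob_cases[OF assms] .
  obtain Y where Y: "\<Phi>o A = free_action Y" using Ob_cases[OF \<Phi>o_Ob[OF assms]] .
  have cl: "a @ b \<in> sgrp A" if "a \<in> sgrp A" "b \<in> sgrp A" for a b
    using that by (simp add: X)
  have cl2: "(a @ fst p, snd p) \<in> pts A" if "a \<in> sgrp A" "p \<in> pts A" for a p
    using that by (auto simp: X)
  have ops: "mul A = (@)" "act A a p = (a @ fst p, snd p)" "mul (\<Phi>o A) = (@)"
    "act (\<Phi>o A) a p = (a @ fst p, snd p)" for a p
    unfolding Y by (simp_all add: X)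
  show ?thesis
    unfolding Hom_def component_def
    using word_map_in[OF assms] point_map_in[OF assms] word_map_mul[OF assms] point_map_act[OF assms] cl cl2
    by (simp add: ops)
qed

end


section \<open>Equality of the families of closed relations\<close>

text \<open>The compatibility condition makes \<open>T\<close> the inverse image of
  \<open>\<alpha> A T\<close> along the isomorphism \<open>component A\<close>. Closedness over
  \<open>H2\<close> survives inverse images, which gives one inclusion; surjectivity of
  \<open>\<alpha> A\<close> gives the other.\<close>

lemma alg_closed_eq_of_automorphism:
  assumes H: "is_action H1" "is_action H2" and aut: "category_automorphism \<Phi>o \<Phi>m"
    and \<alpha>: "\<And>A. A \<in> Ob \<Longrightarrow> bij_betw (\<alpha> A) (alg_closed H1 A) (alg_closed H2 (\<Phi>o A))"
    and eq: "\<And>A1 A2 \<mu>1 \<mu>2 T. A1 \<in> Ob \<Longrightarrow> A2 \<in> Ob \<Longrightarrow> \<mu>1 \<in> Hom A1 A2 \<Longrightarrow> \<mu>2 \<in> Hom A1 A2 \<Longrightarrow>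
      T \<in> alg_closed H1 A2 \<Longrightarrow>
      hom_comp A1 (quot_map A2 T) \<mu>1 = hom_comp A1 (quot_map A2 T) \<mu>2 \<longleftrightarrow>
      hom_comp (\<Phi>o A1) (quot_map (\<Phi>o A2) (\<alpha> A2 T)) (\<Phi>m A1 A2 \<mu>1) =
      hom_comp (\<Phi>o A1) (quot_map (\<Phi>o A2) (\<alpha> A2 T)) (\<Phi>m A1 A2 \<mu>2)"
    and A: "A \<in> Ob"
  shows "alg_closed H1 A = alg_closed H2 A"
proof -
  interpret free_category_automorphism \<Phi>o \<Phi>m by standard (rule aut)
  let ?s = "component A"
  have isA: "is_action A" "is_action (\<Phi>o A)" using A by (simp_all add: Ob_is_action)
  have pull: "pullback A ?s (\<alpha> A T) = T" if T: "T \<in> alg_closed H1 A" for T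
  proof -
    have T': "\<alpha> A T \<in> alg_closed H2 (\<Phi>o A)" using \<alpha>[OF A] T bij_betwE by metis
    have 1: "(Inl a, Inl b) \<in> T \<longleftrightarrow> (Inl (word_map A a), Inl (word_map A b)) \<in> \<alpha> A T"
      if ab: "a \<in> sgrp A" "b \<in> sgrp A" for a b
    proof -
      \<comment> \<open>For the arrows picking \<open>a\<close> and \<open>b\<close>, the
        compatibility condition concerns a single generator and so a single pair on each
        side.\<close>
      have m: "word_arrow a \<in> Hom free_word A" "word_arrow b \<in> Hom free_word A"
        using ab A by (simp_all add: word_arrow_in_Hom)
      note m' = m[THEN \<Phi>m_Hom[OF free_word_Ob A], unfolded \<Phi>o_letter]
      show ?thesis
        using quot_map_comp_eq_iff[OF T isA(1) H(1) m] quot_map_comp_eq_iff[OF T' isA(2) H(2) m']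
          eq[OF free_word_Ob A m T] by (simp add: \<Phi>o_letter word_map_def)
    qed
    have 2: "(Inr a, Inr b) \<in> T \<longleftrightarrow> (Inr (point_map A a), Inr (point_map A b)) \<in> \<alpha> A T"
      if ab: "a \<in> pts A" "b \<in> pts A" for a b
    proof -
      have m: "point_arrow a \<in> Hom free_point A" "point_arrow b \<in> Hom free_point A"
        using ab A by (simp_all add: point_arrow_in_Hom)
      note m' = m[THEN \<Phi>m_Hom[OF free_point_Ob A], unfolded \<Phi>o_base]
      show ?thesis
        using quot_map_comp_eq_iff[OF T isA(1) H(1) m] quot_map_comp_eq_iff[OF T' isA(2) H(2) m']
          eq[OF free_point_Ob A m T] by (simp add: \<Phi>o_base point_map_def)
    qed
    have "T \<subseteq> sort_square A" using T by (simp add: alg_closed_def)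
    moreover have "(u, v) \<in> pullback A ?s (\<alpha> A T) \<longleftrightarrow> (u, v) \<in> T" if "(u, v) \<in> sort_square A" for u v
      using that 1 2 by (auto simp: pullback_def sort_square_def component_def)
    moreover have "pullback A ?s (\<alpha> A T) \<subseteq> sort_square A" by (auto simp: pullback_def)
    ultimately show ?thesis by auto
  qed
  show ?thesis
  proof (intro equalityI subsetI)
    fix T assume T: "T \<in> alg_closed H1 A"
    then have "\<alpha> A T \<in> alg_closed H2 (\<Phi>o A)" using \<alpha>[OF A] bij_betwE by metis
    from pullback_alg_closed[OF isA(1) component_in_Hom[OF A] this] show "T \<in> alg_closed H2 A"
      using pull[OF T] by simp
  next
    fix S assume S: "S \<in> alg_closed H2 A"
    obtain t where t: "t \<in> Hom (\<Phi>o A) A" "\<And>a. a \<in> sgrp A \<Longrightarrow> fst t (fst ?s a) = a"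
      "\<And>y. y \<in> pts A \<Longrightarrow> snd t (snd ?s y) = y"
      using bij_hom_inverse[OF isA(1) component_in_Hom[OF A] component_bij[OF A]] by metis
    \<comment> \<open>\<open>S\<close> is moved to \<open>\<Phi>o A\<close> along the inverse
      isomorphism, where it is some \<open>\<alpha> A T\<close>; pulling back again shows that
      \<open>S\<close> is this \<open>T\<close>.\<close>
    have "pullback (\<Phi>o A) t S \<in> alg_closed H2 (\<Phi>o A)"
      by (rule pullback_alg_closed[OF isA(2) t(1) S])
    then have "pullback (\<Phi>o A) t S \<in> \<alpha> A ` alg_closed H1 A"
      using \<alpha>[OF A] by (simp add: bij_betw_def)
    then obtain T where T: "T \<in> alg_closed H1 A" "\<alpha> A T = pullback (\<Phi>o A) t S"
      by blast
    have "S = pullback A ?s (pullback (\<Phi>o A) t S)"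
      using pullback_pullback[OF component_in_Hom[OF A] _ t(2,3), of S] S by (simp add: alg_closed_def)
    also have "\<dots> = T" using pull[OF T(1)] T(2) by simp
    finally show "S \<in> alg_closed H1 A" using T(1) by simp
  qed
qed

theorem theorem5p1:
  fixes H1 :: "('a, 'b) sg_action" and H2 :: "('c, 'd) sg_action"
  assumes "is_action H1" and "is_action H2"
  shows "automorphically_equivalent H1 H2 \<longleftrightarrow> geometrically_equivalent H1 H2"
proof
  assume "automorphically_equivalent H1 H2"
  then show "geometrically_equivalent H1 H2"
    unfolding automorphically_equivalent_def geometrically_equivalent_iff
    using alg_closed_eq_of_automorphism[OF assms] by (elim exE conjE) metis
next
  assume "geometrically_equivalent H1 H2"
  \<comment> \<open>The families of closed relations coincide, so the identity functor with identity
    bijections is a witness and the compatibility condition is trivial.\<close>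
  then have "bij_betw id (alg_closed H1 A) (alg_closed H2 A)" if "A \<in> Ob" for A
    using that by (simp add: geometrically_equivalent_iff)
  moreover have "category_automorphism id (\<lambda>A B. id)"
    by (simp add: category_automorphism_def)
  ultimately show "automorphically_equivalent H1 H2"
    unfolding automorphically_equivalent_def
    by (intro exI[of _ id] exI[of _ "\<lambda>A B. id"] exI[of _ "\<lambda>A. id"] conjI) auto
qed

end
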